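(* Let $M$ be an orientable $(2,3)$ sub-Riemannian manifold with associated co-metric $g$. Suppose $\nabla$ and $\bar\nabla$ are two affine connections on $M$ compatible with $g$. Let $T$ and $R_{\mathcal{H}}$ be the torsion tensor and the horizontal curvature operator of $\nabla$, and let $\bar T$ and $\bar R_{\mathcal{H}}$ be the torsion tensor and the horizontal curvature operator of $\bar\nabla$. Then $\nabla=\bar\nabla$ if and only if $T=\bar T$ and $R_{\mathcal{H}}=\bar R_{\mathcal{H}}$.
   Context: A sub-Riemannian structure on a smooth manifold $M$ is a pair $(\mathcal{H},\langle\cdot,\cdot\rangle)$ with $\mathcal{H}$ a smooth sub-bundle of $TM$ and $\langle\cdot,\cdot\rangle$ a smooth fiber inner product on $\mathcal{H}$. A $(2,3)$ sub-Riemannian manifold is a smooth $3$-manifold with such a structure in which $\mathcal{H}$ has rank $2$ and, at every point, $\mathcal{H}$ together with brackets of local sections of $\mathcal{H}$ spans the tangent space. The associated co-metric is the symmetric $(2,0)$-tensor $g$ given locally by $g=X_1\otimes X_1+X_2\otimes X_2$ for any orthonormal frame $\{X_1,X_2\}$ of $\mathcal{H}$. An affine connection $\nabla$ is compatible with $g$ if $\nabla g=0$. Its torsion and curvature are $T(V_1,V_2)=\nabla_{V_1}V_2-\nabla_{V_2}V_1-[V_1,V_2]$ and $R(V_1,V_2)V_3=\nabla_{V_1}\nabla_{V_2}V_3-\nabla_{V_2}\nabla_{V_1}V_3-\nabla_{[V_1,V_2]}V_3$. For an oriented orthonormal frame $\{X_1,X_2\}$ of $\mathcal{H}$ on an open set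 $U$ (and $X_3=[X_1,X_2]$), the horizontal curvature operator on $U$ is $R_{\mathcal{H}}V=R(X_1,X_2)V=\nabla_{X_1}\nabla_{X_2}V-\nabla_{X_2}\nabla_{X_1}V-\nabla_{X_3}V$; it is unchanged when the frame is rotated, and $R_{\mathcal{H}}$, $\bar R_{\mathcal{H}}$ are computed with the same frames. *)

theory Defs
  imports "HOL-Analysis.Analysis" "HOL-Library.Function_Algebras"
begin

section \<open>Smooth functions on Euclidean space\<close>

primrec Ck_on :: "nat \<Rightarrow> 'e::euclidean_space set \<Rightarrow> ('e \<Rightarrow> 'b::real_normed_vector) \<Rightarrow> bool" where
  "Ck_on 0 S f \<longleftrightarrow> continuous_on S f"
| "Ck_on (Suc k) S f \<longleftrightarrow>
     (\<forall>x\<in>S. f differentiable (at x)) \<and> (\<forall>v. Ck_on k S (\<lambda>x. frechet_derivative f (at x) v))"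

text \<open>Only used for open sets.\<close>

definition smooth_on :: "'e::euclidean_space set \<Rightarrow> ('e \<Rightarrow> 'b::real_normed_vector) \<Rightarrow> bool" where
  "smooth_on S f \<longleftrightarrow> (\<forall>k. Ck_on k S f)"


section \<open>Smooth 3-manifolds\<close>

text \<open>
  The manifold is the whole type \<open>'a\<close>, whose class carries the topology (Hausdorff and second
  countable). A chart is a pair of an open domain and a coordinate map. The atlas need
  not be maximal.
\<close>

type_synonym 'a chart = "'a set \<times> ('a \<Rightarrow> real ^ 3)"

definition smooth_atlas :: "('a::{t2_space, second_countable_topology}) chart set \<Rightarrow> bool" where
  "smooth_atlas A \<longleftrightarrow>
     (\<Union>(D, \<phi>)\<in>A. D) = UNIV \<and>
     (\<forall>(D, \<phi>)\<in>A. open D \<and> open (\<phi> ` D) \<and> homeomorphism D (\<phi> ` D) \<phi> (inv_into D \<phi>)) \<and>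
     (\<forall>(D, \<phi>)\<in>A. \<forall>(E, \<psi>)\<in>A. smooth_on (\<phi> ` (D \<inter> E)) (\<psi> \<circ> inv_into D \<phi>))"

definition smooth_fun :: "('a::topological_space) chart set \<Rightarrow> 'a set \<Rightarrow> ('a \<Rightarrow> real) \<Rightarrow> bool" where
  "smooth_fun A U f \<longleftrightarrow> (\<forall>(D, \<phi>)\<in>A. smooth_on (\<phi> ` (D \<inter> U)) (f \<circ> inv_into D \<phi>))"

definition smooth_near :: "('a::topological_space) chart set \<Rightarrow> 'a \<Rightarrow> ('a \<Rightarrow> real) \<Rightarrow> bool" where
  "smooth_near A p f \<longleftrightarrow> (\<exists>U. open U \<and> p \<in> U \<and> smooth_fun A U f)"


section \<open>Tangent vectors and vector fields\<close>

text \<open>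
  A tangent vector at \<open>p\<close> is a derivation of the algebra of germs at \<open>p\<close> of smooth
  functions. It is represented as a functional on all functions, which takes equal values on
  functions with the same germ and is set to \<open>0\<close> on functions that are not smooth near \<open>p\<close>.
  Addition of tangent vectors and of vector fields is the pointwise one of
  \<^theory>\<open>HOL-Library.Function_Algebras\<close>.
\<close>

type_synonym 'a tvec = "('a \<Rightarrow> real) \<Rightarrow> real"
type_synonym 'a vfield = "'a \<Rightarrow> 'a tvec"

definition tscale :: "real \<Rightarrow> ('b \<Rightarrow> real) \<Rightarrow> ('b \<Rightarrow> real)" where
  "tscale c v = (\<lambda>x. c * v x)"

global_interpretation tv: vector_space "tscale :: real \<Rightarrow> ('b \<Rightarrow> real) \<Rightarrow> ('b \<Rightarrow> real)"
  by unfold_locales (auto simp: tscale_def fun_eq_iff algebra_simps)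

definition tangent_space :: "('a::topological_space) chart set \<Rightarrow> 'a \<Rightarrow> 'a tvec set" where
  "tangent_space A p = {v.
     (\<forall>f. \<not> smooth_near A p f \<longrightarrow> v f = 0) \<and>
     (\<forall>f g. smooth_near A p f \<and> smooth_near A p g \<longrightarrow>
        ((\<forall>\<^sub>F q in nhds p. f q = g q) \<longrightarrow> v f = v g) \<and>
        (\<forall>a b. v (\<lambda>q. a * f q + b * g q) = a * v f + b * v g) \<and>
        v (\<lambda>q. f q * g q) = f p * v g + v f * g p)}"

text \<open>Smooth vector fields over an open set \<open>U\<close>; values outside \<open>U\<close> are irrelevant.\<close>

definition vfields :: "('a::topological_space) chart set \<Rightarrow> 'a set \<Rightarrow> 'a vfield set" where
  "vfields A U = {V.
     (\<forall>p\<in>U. V p \<in> tangent_space A p) \<and>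
     (\<forall>W f. open W \<and> W \<subseteq> U \<and> smooth_fun A W f \<longrightarrow> smooth_fun A W (\<lambda>p. V p f))}"

definition fscale :: "('a \<Rightarrow> real) \<Rightarrow> 'a vfield \<Rightarrow> 'a vfield" where
  "fscale f V = (\<lambda>p. tscale (f p) (V p))"

definition lie_bracket :: "('a::topological_space) chart set \<Rightarrow> 'a vfield \<Rightarrow> 'a vfield \<Rightarrow> 'a vfield" where
  "lie_bracket A V W = (\<lambda>p f.
     if smooth_near A p f then V p (\<lambda>q. W q f) - W p (\<lambda>q. V q f) else 0)"


section \<open>\<open>(2,3)\<close> sub-Riemannian structures\<close>

type_synonym 'a distribution = "'a \<Rightarrow> 'a tvec set"
type_synonym 'a fiber_metric = "'a \<Rightarrow> 'a tvec \<Rightarrow> 'a tvec \<Rightarrow> real"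

definition fiber_basis :: "'a distribution \<Rightarrow> 'a \<Rightarrow> 'a tvec \<Rightarrow> 'a tvec \<Rightarrow> bool" where
  "fiber_basis H p x y \<longleftrightarrow> x \<noteq> y \<and> tv.independent {x, y} \<and> tv.span {x, y} = H p"

definition hframe ::
  "('a::topological_space) chart set \<Rightarrow> 'a distribution \<Rightarrow> 'a set \<Rightarrow> 'a vfield \<Rightarrow> 'a vfield \<Rightarrow> bool" where
  "hframe A H U X1 X2 \<longleftrightarrow> open U \<and> X1 \<in> vfields A U \<and> X2 \<in> vfields A U \<and>
     (\<forall>q\<in>U. fiber_basis H q (X1 q) (X2 q))"

definition rank2_subbundle :: "('a::topological_space) chart set \<Rightarrow> 'a distribution \<Rightarrow> bool" where
  "rank2_subbundle A H \<longleftrightarrow> (\<forall>p. \<exists>U X1 X2. p \<in> U \<and> hframe A H U X1 X2)"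

definition hsections :: "('a::topological_space) chart set \<Rightarrow> 'a distribution \<Rightarrow> 'a set \<Rightarrow> 'a vfield set" where
  "hsections A H U = {V \<in> vfields A U. \<forall>q\<in>U. V q \<in> H q}"

definition bracket_generating :: "('a::topological_space) chart set \<Rightarrow> 'a distribution \<Rightarrow> bool" where
  "bracket_generating A H \<longleftrightarrow> (\<forall>p.
     tv.span (H p \<union> {lie_bracket A V W p | U V W.
       open U \<and> p \<in> U \<and> V \<in> hsections A H U \<and> W \<in> hsections A H U}) = tangent_space A p)"

definition smooth_fiber_inner ::
  "('a::topological_space) chart set \<Rightarrow> 'a distribution \<Rightarrow> 'a fiber_metric \<Rightarrow> bool" where
  "smooth_fiber_inner A H ip \<longleftrightarrow>
     (\<forall>p. \<forall>x\<in>H p. \<forall>y\<in>H p.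
        ip p x y = ip p y x \<and>
        (\<forall>z\<in>H p. \<forall>a b. ip p (tscale a x + tscale b y) z = a * ip p x z + b * ip p y z) \<and>
        (x \<noteq> 0 \<longrightarrow> ip p x x > 0)) \<and>
     (\<forall>U V W. open U \<and> V \<in> hsections A H U \<and> W \<in> hsections A H U \<longrightarrow>
        smooth_fun A U (\<lambda>q. ip q (V q) (W q)))"

definition sub_riemannian_2_3 ::
  "('a::{t2_space, second_countable_topology}) chart set \<Rightarrow> 'a distribution \<Rightarrow> 'a fiber_metric \<Rightarrow> bool" where
  "sub_riemannian_2_3 A H ip \<longleftrightarrow>
     smooth_atlas A \<and> rank2_subbundle A H \<and> smooth_fiber_inner A H ip \<and> bracket_generating A H"

text \<open>
  An orientation of the bundle \<open>H\<close>: \<open>pos p x y\<close> says that the ordered basis \<open>(x, y)\<close> of \<open>H p\<close>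
  is positively oriented. At each point the positive bases form one of the two classes of bases
  modulo positive determinant, and this choice is locally given by a smooth frame.
  It is \<open>H\<close> that has to be oriented for oriented frames to make sense. The 3-manifold
  itself is always orientable, because \<open>X1 \<and> X2 \<and> [X1, X2]\<close> changes by the square of the
  determinant when the frame \<open>X1\<close>, \<open>X2\<close> of \<open>H\<close> changes.
\<close>

definition hbundle_orientation ::
  "('a::topological_space) chart set \<Rightarrow> 'a distribution \<Rightarrow> ('a \<Rightarrow> 'a tvec \<Rightarrow> 'a tvec \<Rightarrow> bool) \<Rightarrow> bool" where
  "hbundle_orientation A H pos \<longleftrightarrow>
     (\<forall>p x y a b c d. fiber_basis H p x y \<and> a * d - b * c \<noteq> 0 \<longrightarrow>
        (pos p (tscale a x + tscale b y) (tscale c x + tscale d y)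
           \<longleftrightarrow> (pos p x y \<longleftrightarrow> a * d - b * c > 0))) \<and>
     (\<forall>p. \<exists>U X1 X2. p \<in> U \<and> hframe A H U X1 X2 \<and> (\<forall>q\<in>U. pos q (X1 q) (X2 q)))"

definition orthonormal_frame ::
  "('a::topological_space) chart set \<Rightarrow> 'a distribution \<Rightarrow> 'a fiber_metric \<Rightarrow> 'a set
     \<Rightarrow> 'a vfield \<Rightarrow> 'a vfield \<Rightarrow> bool" where
  "orthonormal_frame A H ip U X1 X2 \<longleftrightarrow> hframe A H U X1 X2 \<and>
     (\<forall>q\<in>U. ip q (X1 q) (X1 q) = 1 \<and> ip q (X2 q) (X2 q) = 1 \<and> ip q (X1 q) (X2 q) = 0)"

definition oriented_orthonormal_frame ::
  "('a::topological_space) chart set \<Rightarrow> 'a distribution \<Rightarrow> 'a fiber_metric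
     \<Rightarrow> ('a \<Rightarrow> 'a tvec \<Rightarrow> 'a tvec \<Rightarrow> bool) \<Rightarrow> 'a set \<Rightarrow> 'a vfield \<Rightarrow> 'a vfield \<Rightarrow> bool" where
  "oriented_orthonormal_frame A H ip pos U X1 X2 \<longleftrightarrow>
     orthonormal_frame A H ip U X1 X2 \<and> (\<forall>q\<in>U. pos q (X1 q) (X2 q))"


section \<open>Covectors, one-forms and the co-metric\<close>

text \<open>Covectors at \<open>p\<close> only matter through their values on \<open>tangent_space A p\<close>.\<close>

type_synonym 'a covec = "'a tvec \<Rightarrow> real"
type_synonym 'a cometric = "'a \<Rightarrow> 'a covec \<Rightarrow> 'a covec \<Rightarrow> real"

definition cotangent_space :: "('a::topological_space) chart set \<Rightarrow> 'a \<Rightarrow> 'a covec set" where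
  "cotangent_space A p = {\<alpha>. \<forall>v\<in>tangent_space A p. \<forall>w\<in>tangent_space A p. \<forall>a b.
     \<alpha> (tscale a v + tscale b w) = a * \<alpha> v + b * \<alpha> w}"

definition one_forms :: "('a::topological_space) chart set \<Rightarrow> ('a \<Rightarrow> 'a covec) set" where
  "one_forms A = {\<alpha>.
     (\<forall>p. \<alpha> p \<in> cotangent_space A p) \<and>
     (\<forall>U V. open U \<and> V \<in> vfields A U \<longrightarrow> smooth_fun A U (\<lambda>q. \<alpha> q (V q)))}"

text \<open>The co-metric is \<open>X1 \<otimes> X1 + X2 \<otimes> X2\<close>, viewed as a bilinear form on covectors.\<close>

definition associated_cometric ::
  "('a::topological_space) chart set \<Rightarrow> 'a distribution \<Rightarrow> 'a fiber_metric \<Rightarrow> 'a cometric \<Rightarrow> bool" where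
  "associated_cometric A H ip g \<longleftrightarrow>
     (\<forall>U X1 X2. orthonormal_frame A H ip U X1 X2 \<longrightarrow>
        (\<forall>p\<in>U. \<forall>\<alpha>\<in>cotangent_space A p. \<forall>\<beta>\<in>cotangent_space A p.
           g p \<alpha> \<beta> = \<alpha> (X1 p) * \<beta> (X1 p) + \<alpha> (X2 p) * \<beta> (X2 p)))"


section \<open>Affine connections\<close>

type_synonym 'a connection = "'a vfield \<Rightarrow> 'a vfield \<Rightarrow> 'a vfield"

definition affine_connection :: "('a::topological_space) chart set \<Rightarrow> 'a connection \<Rightarrow> bool" where
  "affine_connection A nabla \<longleftrightarrow>
     (\<forall>V\<in>vfields A UNIV. \<forall>W\<in>vfields A UNIV. nabla V W \<in> vfields A UNIV) \<and>
     (\<forall>V\<in>vfields A UNIV. \<forall>V'\<in>vfields A UNIV. \<forall>W\<in>vfields A UNIV. \<forall>f f'.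
        smooth_fun A UNIV f \<and> smooth_fun A UNIV f' \<longrightarrow>
        nabla (fscale f V + fscale f' V') W = fscale f (nabla V W) + fscale f' (nabla V' W)) \<and>
     (\<forall>V\<in>vfields A UNIV. \<forall>W\<in>vfields A UNIV. \<forall>W'\<in>vfields A UNIV.
        nabla V (W + W') = nabla V W + nabla V W') \<and>
     (\<forall>V\<in>vfields A UNIV. \<forall>W\<in>vfields A UNIV. \<forall>f. smooth_fun A UNIV f \<longrightarrow>
        nabla V (fscale f W) = fscale (\<lambda>p. V p f) W + fscale f (nabla V W))"

text \<open>
  The covariant derivative of a one-form, \<open>(\<nabla>\<^sub>V \<alpha>)(W) = V (\<alpha> W) - \<alpha> (\<nabla>\<^sub>V W)\<close>, as a covector at
  each point: the right-hand side at \<open>p\<close> depends on \<open>W\<close> only through the value \<open>W p\<close>.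
\<close>

definition cov_deriv_form ::
  "('a::topological_space) chart set \<Rightarrow> 'a connection \<Rightarrow> 'a vfield \<Rightarrow> ('a \<Rightarrow> 'a covec) \<Rightarrow> ('a \<Rightarrow> 'a covec)" where
  "cov_deriv_form A nabla V \<alpha> = (\<lambda>p w. THE c. \<exists>W\<in>vfields A UNIV.
     W p = w \<and> c = V p (\<lambda>q. \<alpha> q (W q)) - \<alpha> p (nabla V W p))"

definition cov_deriv_cometric ::
  "('a::topological_space) chart set \<Rightarrow> 'a connection \<Rightarrow> 'a vfield \<Rightarrow> 'a cometric
     \<Rightarrow> ('a \<Rightarrow> 'a covec) \<Rightarrow> ('a \<Rightarrow> 'a covec) \<Rightarrow> ('a \<Rightarrow> real)" where
  "cov_deriv_cometric A nabla V g \<alpha> \<beta> = (\<lambda>p.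
     V p (\<lambda>q. g q (\<alpha> q) (\<beta> q))
     - g p (cov_deriv_form A nabla V \<alpha> p) (\<beta> p)
     - g p (\<alpha> p) (cov_deriv_form A nabla V \<beta> p))"

definition compatible :: "('a::topological_space) chart set \<Rightarrow> 'a cometric \<Rightarrow> 'a connection \<Rightarrow> bool" where
  "compatible A g nabla \<longleftrightarrow>
     (\<forall>V\<in>vfields A UNIV. \<forall>\<alpha>\<in>one_forms A. \<forall>\<beta>\<in>one_forms A. \<forall>p.
        cov_deriv_cometric A nabla V g \<alpha> \<beta> p = 0)"

text \<open>
  The connection induced on an open set \<open>U\<close>: its value at \<open>p\<close> is computed from any global
  fields that agree with the given ones near \<open>p\<close>. Such fields exist by means of bump functions,
  and by locality of connections the value does not depend on their choice.
\<close>

definition restrict_connection ::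
  "('a::topological_space) chart set \<Rightarrow> 'a connection \<Rightarrow> 'a set \<Rightarrow> 'a connection" where
  "restrict_connection A nabla U V W = (\<lambda>p. if p \<in> U then
     (THE z. \<exists>V'\<in>vfields A UNIV. \<exists>W'\<in>vfields A UNIV.
        (\<forall>\<^sub>F q in nhds p. V' q = V q \<and> W' q = W q) \<and> z = nabla V' W' p)
     else 0)"

definition torsion :: "('a::topological_space) chart set \<Rightarrow> 'a connection \<Rightarrow> 'a vfield \<Rightarrow> 'a vfield \<Rightarrow> 'a vfield" where
  "torsion A nabla V1 V2 = nabla V1 V2 - nabla V2 V1 - lie_bracket A V1 V2"

definition curvature ::
  "('a::topological_space) chart set \<Rightarrow> 'a connection \<Rightarrow> 'a vfield \<Rightarrow> 'a vfield \<Rightarrow> 'a vfield \<Rightarrow> 'a vfield" where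
  "curvature A nabla V1 V2 V3 =
     nabla V1 (nabla V2 V3) - nabla V2 (nabla V1 V3) - nabla (lie_bracket A V1 V2) V3"

text \<open>
  The horizontal curvature operator on \<open>U\<close> with respect to a frame \<open>X1\<close>, \<open>X2\<close> over \<open>U\<close>, applied
  to a vector field \<open>V\<close> over \<open>U\<close>.
\<close>

definition horizontal_curvature ::
  "('a::topological_space) chart set \<Rightarrow> 'a connection \<Rightarrow> 'a set \<Rightarrow> 'a vfield \<Rightarrow> 'a vfield \<Rightarrow> 'a vfield \<Rightarrow> 'a vfield" where
  "horizontal_curvature A nabla U X1 X2 V = curvature A (restrict_connection A nabla U) X1 X2 V"

end

theory Submission
  imports Defs
begin

text \<open>
  Let \<open>D = \<nabla> - \<nabla>'\<close>. In an oriented orthonormal frame \<open>X1, X2\<close> of \<open>H\<close>, compatibility with \<open>g\<close>, tested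
  on exact one-forms only, says \<open>\<nabla>\<^sub>V X1 = \<omega>(V) X2\<close> and \<open>\<nabla>\<^sub>V X2 = - \<omega>(V) X1\<close>. If the torsions agree
  then \<open>D\<close> is symmetric, and \<open>D(X1, X2) = D(X2, X1)\<close> forces \<open>\<omega>\<close> and \<open>\<omega>'\<close> to agree on \<open>H\<close>, so
  \<open>D\<close> vanishes on \<open>H \<times> H\<close>. With \<open>X3 = [X1, X2]\<close>, the second-order terms of the horizontal
  curvatures of \<open>X1\<close> then agree, which leaves \<open>D(X3, X1) = 0\<close>; hence \<open>\<omega>(X3) = \<omega>'(X3)\<close> and
  \<open>D(X3, X2) = 0\<close>. By symmetry \<open>D(X1, _) = D(X2, _) = 0\<close>, and the horizontal curvature of \<open>X3\<close> gives
  \<open>D(X3, X3) = 0\<close>. The bracket-generating condition makes \<open>X1, X2, X3\<close> a frame of the tangent bundle.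
\<close>

section \<open>Calculus of smooth functions\<close>

text \<open>The co-metric is degenerate, so compatibility constrains \<open>nabla V X1\<close> and
  \<open>nabla V X2\<close> but says nothing about the derivative of the transverse field
  \<open>X3\<close>. Equal torsions relate \<open>D(X3, X1)\<close> only to the unconstrained
  \<open>D(X1, X3)\<close>, which is why curvature has to enter. Its bracket term contributes
  \<open>nabla X3 V\<close> to first order, and this is where transverse derivatives are read off:
  applied to \<open>X1\<close> it fixes the connection form on \<open>X3\<close>, applied to
  \<open>X3\<close> it fixes the last component. Two obstacles shape the preparation. Connections
  act on global fields while frames and curvature are local, hence cutoff functions, global
  extensions and locality lemmas. Tangent vectors are abstract derivations, so independence of
  \<open>X1, X2, X3\<close> is read off in coordinates: the three fields span a space that contains
  the coordinate derivations, hence the matrix of their values on the three coordinate functions is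
  invertible. Solving with this matrix also gives global functions with prescribed derivatives along
  the frame, which is why exact forms are rich enough as test forms; Cramer's rule gives smooth
  coefficients.\<close>

lemma Ck_on_cong:
  assumes "open S" "\<And>x. x \<in> S \<Longrightarrow> f x = g x" "Ck_on k S f"
  shows "Ck_on k S g"
  using assms
proof (induction k arbitrary: f g)
  case 0
  then show ?case by (metis Ck_on.simps(1) continuous_on_cong)
next
  case (Suc k)
  have d: "f differentiable (at x)" if "x \<in> S" for x
    using Suc.prems that by simp
  have eq: "frechet_derivative f (at x) = frechet_derivative g (at x)" if "x \<in> S" for x
    by (rule frechet_derivative_transform_within_open[OF d[OF that] Suc.prems(1) that Suc.prems(2)])
  have "g differentiable (at x)" if x: "x \<in> S" for x
  proof -
    have "(f has_derivative frechet_derivative f (at x)) (at x)"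
      using d[OF x] frechet_derivative_works by blast
    then have "(g has_derivative frechet_derivative f (at x)) (at x)"
      using has_derivative_transform_within_open[OF _ Suc.prems(1) x] Suc.prems(2) by blast
    then show ?thesis by (auto simp: differentiable_def)
  qed
  moreover have "Ck_on k S (\<lambda>x. frechet_derivative g (at x) v)" for v
    by (rule Suc.IH[of "\<lambda>x. frechet_derivative f (at x) v"]) (use Suc.prems eq in auto)
  ultimately show ?case by simp
qed

text \<open>Uniqueness of derivatives lets an explicit formula \<open>f'\<close> stand in for the
  chosen \<open>frechet_derivative\<close> of the recursion. All closure rules below go through
  it.\<close>

lemma Ck_on_SucI:
  assumes "open S" "\<And>x. x \<in> S \<Longrightarrow> (f has_derivative f' x) (at x)" "\<And>v. Ck_on k S (\<lambda>x. f' x v)"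
  shows "Ck_on (Suc k) S f"
proof -
  have "Ck_on k S (\<lambda>x. frechet_derivative f (at x) v)" for v
    by (rule Ck_on_cong[OF assms(1) _ assms(3)[of v]]) (simp add: frechet_derivative_at[OF assms(2), symmetric])
  then show ?thesis using assms(2) by (auto simp: differentiable_def)
qed

lemma Ck_on_Suc_has_derivative:
  "Ck_on (Suc k) S f \<Longrightarrow> x \<in> S \<Longrightarrow> (f has_derivative frechet_derivative f (at x)) (at x)"
  using frechet_derivative_works by auto

lemma Ck_on_Suc_imp: "Ck_on (Suc k) S f \<Longrightarrow> Ck_on k S f"
proof (induction k arbitrary: f)
  case 0
  then show ?case
    by (auto intro!: continuous_at_imp_continuous_on differentiable_imp_continuous_within)
next
  case (Suc k)
  have "f differentiable (at x)" if "x \<in> S" for x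
    using Suc.prems that by (simp only: Ck_on.simps)
  moreover have "Ck_on (Suc k) S (\<lambda>x. frechet_derivative f (at x) v)" for v
    using Ck_on.simps(2)[of "Suc k" S f] Suc.prems by blast
  ultimately show ?case using Suc.IH by simp
qed

lemma Ck_on_subset: "Ck_on k T f \<Longrightarrow> S \<subseteq> T \<Longrightarrow> Ck_on k S f"
  by (induction k arbitrary: f) (auto intro: continuous_on_subset)

lemma Ck_on_local:
  assumes "\<And>x. x \<in> S \<Longrightarrow> \<exists>T. open T \<and> x \<in> T \<and> Ck_on k T f"
  shows "Ck_on k S f"
  using assms
proof (induction k arbitrary: f)
  case 0
  have "isCont f x" if "x \<in> S" for x
    using 0[OF that] continuous_on_eq_continuous_at by auto
  then show ?case by (auto intro: continuous_at_imp_continuous_on)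
next
  case (Suc k)
  have "f differentiable (at x)" if "x \<in> S" for x
    using Suc.prems[OF that] by auto
  moreover have "Ck_on k S (\<lambda>x. frechet_derivative f (at x) v)" for v
  proof (rule Suc.IH)
    show "\<exists>T. open T \<and> x \<in> T \<and> Ck_on k T (\<lambda>x. frechet_derivative f (at x) v)" if "x \<in> S" for x
      using Suc.prems[OF that] by auto
  qed
  ultimately show ?case by simp
qed

lemma Ck_on_const: "open S \<Longrightarrow> Ck_on k S (\<lambda>x. c)"
proof (induction k arbitrary: c)
  case (Suc k)
  show ?case by (rule Ck_on_SucI[where f' = "\<lambda>x v. 0"]) (use Suc in auto)
qed simp

lemma Ck_on_bounded_linear:
  assumes L: "bounded_linear L" and S: "open S" and f: "Ck_on k S f"
  shows "Ck_on k S (\<lambda>x. L (f x))"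
  using f
proof (induction k arbitrary: f)
  case 0
  then show ?case using bounded_linear.continuous_on[OF L] by auto
next
  case (Suc k)
  show ?case
    by (rule Ck_on_SucI[OF S bounded_linear.has_derivative[OF L Ck_on_Suc_has_derivative[OF Suc.prems]]])
      (use Suc in auto)
qed

lemma Ck_on_ident: "open S \<Longrightarrow> Ck_on k S (\<lambda>x. x)"
proof (cases k)
  case (Suc m)
  assume S: "open S"
  show ?thesis unfolding Suc
    by (rule Ck_on_SucI[where f' = "\<lambda>x v. v"]) (use Ck_on_const S in auto)
qed simp

lemma Ck_on_add:
  assumes S: "open S" and "Ck_on k S f" "Ck_on k S g"
  shows "Ck_on k S (\<lambda>x. f x + g x)"
  using assms(2,3)
proof (induction k arbitrary: f g)
  case (Suc k)
  show ?case
    by (rule Ck_on_SucI[OF S has_derivative_add[OF Ck_on_Suc_has_derivative Ck_on_Suc_has_derivative]])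
      (use Suc in auto)
qed (auto intro: continuous_intros)

lemma Ck_on_sum:
  assumes S: "open S" and "finite I" "\<And>i. i \<in> I \<Longrightarrow> Ck_on k S (f i)"
  shows "Ck_on k S (\<lambda>x. \<Sum>i\<in>I. f i x)"
  using assms(2,3) by (induction I) (auto intro: Ck_on_const Ck_on_add S)

text \<open>One rule for products, scalar multiples and inner products. Each term of the product
  rule pairs an undifferentiated factor, lowered by one order, with a derivative, so the induction
  must range over both factors.\<close>

lemma Ck_on_bilinear:
  assumes B: "bounded_bilinear B" and S: "open S" and "Ck_on k S f" "Ck_on k S g"
  shows "Ck_on k S (\<lambda>x. B (f x) (g x))"
  using assms(3,4)
proof (induction k arbitrary: f g)
  case 0
  then show ?case using bounded_bilinear.continuous_on[OF B] by auto
next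
  case (Suc k)
  show ?case
  proof (rule Ck_on_SucI[OF S bounded_bilinear.FDERIV[OF B Ck_on_Suc_has_derivative Ck_on_Suc_has_derivative]])
    show "Ck_on k S (\<lambda>x. B (f x) (frechet_derivative g (at x) v) + B (frechet_derivative f (at x) v) (g x))" for v
      by (rule Ck_on_add[OF S]; rule Suc.IH) (use Suc.prems Ck_on_Suc_imp in auto)
  qed (use Suc.prems in auto)
qed

lemma Ck_on_compose:
  fixes f :: "'e::euclidean_space \<Rightarrow> 'f::euclidean_space" and g :: "'f \<Rightarrow> 'b::real_normed_vector"
  assumes S: "open S" and T: "open T" and sub: "f ` S \<subseteq> T"
    and "Ck_on k S f" "Ck_on k T g"
  shows "Ck_on k S (\<lambda>x. g (f x))"
  using assms(4,5)
proof (induction k arbitrary: g)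
  case 0
  then show ?case using continuous_on_compose2[OF _ _ sub] by auto
next
  case (Suc k)
  let ?Df = "\<lambda>x. frechet_derivative f (at x)" and ?Dg = "\<lambda>x. frechet_derivative g (at x)"
  show ?case
  proof (rule Ck_on_SucI[OF S])
    fix x assume x: "x \<in> S"
    have g': "(g has_derivative ?Dg (f x)) (at (f x))"
      by (rule Ck_on_Suc_has_derivative[OF Suc.prems(2)]) (use x sub in auto)
    have f': "(f has_derivative ?Df x) (at x)"
      by (rule Ck_on_Suc_has_derivative[OF Suc.prems(1) x])
    have "((\<lambda>x. g (f x)) has_derivative (\<lambda>v. ?Dg (f x) (?Df x v))) (at x)"
      using diff_chain_at[OF f' g'] by (simp add: o_def)
    \<comment> \<open>In the chain rule the direction \<open>?Df x v\<close> moves with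
      \<open>x\<close>, whereas the induction hypothesis speaks of derivatives of \<open>g\<close>
      in fixed directions. Expanding in \<open>Basis\<close> separates the two.\<close>
    moreover have "?Dg (f x) w = (\<Sum>b\<in>Basis. (w \<bullet> b) *\<^sub>R ?Dg (f x) b)" for w
    proof -
      have lin: "linear (?Dg (f x))" using g' has_derivative_linear by blast
      have "?Dg (f x) w = ?Dg (f x) (\<Sum>b\<in>Basis. (w \<bullet> b) *\<^sub>R b)" by (simp add: euclidean_representation)
      also have "\<dots> = (\<Sum>b\<in>Basis. (w \<bullet> b) *\<^sub>R ?Dg (f x) b)"
        by (simp add: linear_sum[OF lin] linear_cmul[OF lin])
      finally show ?thesis .
    qed
    ultimately show "((\<lambda>x. g (f x)) has_derivative
        (\<lambda>v. \<Sum>b\<in>Basis. (?Df x v \<bullet> b) *\<^sub>R ?Dg (f x) b)) (at x)"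
      by (rule has_derivative_eq_rhs[OF _ ext])
  next
    fix v
    show "Ck_on k S (\<lambda>x. \<Sum>b\<in>Basis. (?Df x v \<bullet> b) *\<^sub>R ?Dg (f x) b)"
    proof (rule Ck_on_sum[OF S])
      fix b :: 'f
      have 1: "Ck_on k S (\<lambda>x. ?Df x v \<bullet> b)"
        by (rule Ck_on_bounded_linear[OF bounded_linear_inner_left S]) (use Suc.prems in simp)
      have 2: "Ck_on k S (\<lambda>x. ?Dg (f x) b)"
        by (rule Suc.IH) (use Suc.prems Ck_on_Suc_imp in auto)
      show "Ck_on k S (\<lambda>x. (?Df x v \<bullet> b) *\<^sub>R ?Dg (f x) b)"
        by (rule Ck_on_bilinear[OF bounded_bilinear_scaleR S 1 2])
    qed simp
  qed
qed

lemma smooth_on_cong: "open S \<Longrightarrow> (\<And>x. x \<in> S \<Longrightarrow> f x = g x) \<Longrightarrow> smooth_on S f \<Longrightarrow> smooth_on S g"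
  unfolding smooth_on_def using Ck_on_cong[of S f g] by simp

lemma smooth_on_subset: "smooth_on T f \<Longrightarrow> S \<subseteq> T \<Longrightarrow> smooth_on S f"
  unfolding smooth_on_def using Ck_on_subset[of _ T f S] by simp

lemma smooth_on_local:
  assumes "\<And>x. x \<in> S \<Longrightarrow> \<exists>T. open T \<and> x \<in> T \<and> smooth_on T f"
  shows "smooth_on S f"
  unfolding smooth_on_def
proof
  show "Ck_on k S f" for k
    by (rule Ck_on_local) (use assms in \<open>auto simp: smooth_on_def\<close>)
qed

lemma smooth_on_const: "open S \<Longrightarrow> smooth_on S (\<lambda>x. c)"
  by (simp add: smooth_on_def Ck_on_const)

lemma smooth_on_ident: "open S \<Longrightarrow> smooth_on S (\<lambda>x. x)"
  by (simp add: smooth_on_def Ck_on_ident)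

lemma smooth_on_bounded_linear:
  "bounded_linear L \<Longrightarrow> open S \<Longrightarrow> smooth_on S f \<Longrightarrow> smooth_on S (\<lambda>x. L (f x))"
  by (simp add: smooth_on_def Ck_on_bounded_linear)

lemma smooth_on_add: "open S \<Longrightarrow> smooth_on S f \<Longrightarrow> smooth_on S g \<Longrightarrow> smooth_on S (\<lambda>x. f x + g x)"
  by (simp add: smooth_on_def Ck_on_add)

lemma smooth_on_bilinear:
  "bounded_bilinear B \<Longrightarrow> open S \<Longrightarrow> smooth_on S f \<Longrightarrow> smooth_on S g \<Longrightarrow> smooth_on S (\<lambda>x. B (f x) (g x))"
  by (simp add: smooth_on_def Ck_on_bilinear)

lemmas smooth_on_mult = smooth_on_bilinear[OF bounded_bilinear_mult]

lemma smooth_on_diff: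
  "open S \<Longrightarrow> smooth_on S f \<Longrightarrow> smooth_on S g \<Longrightarrow> smooth_on S (\<lambda>x. f x - g x)"
  using smooth_on_add[OF _ _ smooth_on_bounded_linear[OF bounded_linear_minus[OF bounded_linear_ident]],
      of S f g] by simp

lemma smooth_on_compose:
  fixes f :: "'e::euclidean_space \<Rightarrow> 'f::euclidean_space" and g :: "'f \<Rightarrow> 'b::real_normed_vector"
  shows "open S \<Longrightarrow> open T \<Longrightarrow> f ` S \<subseteq> T \<Longrightarrow> smooth_on S f \<Longrightarrow> smooth_on T g \<Longrightarrow> smooth_on S (\<lambda>x. g (f x))"
  unfolding smooth_on_def using Ck_on_compose[of S T f _ g] by simp

lemma smooth_on_imp_continuous_on: "smooth_on S f \<Longrightarrow> continuous_on S f"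
  using Ck_on.simps(1)[of S f] unfolding smooth_on_def by blast

lemma smooth_on_has_derivative:
  "smooth_on S f \<Longrightarrow> x \<in> S \<Longrightarrow> (f has_derivative frechet_derivative f (at x)) (at x)"
  unfolding smooth_on_def by (rule Ck_on_Suc_has_derivative[where k = 0]) blast+

section \<open>Functions of one real variable, and a smooth cutoff on Euclidean space\<close>

lemma Ck_on_real_SucI:
  fixes f :: "real \<Rightarrow> real"
  assumes S: "open S" and f: "\<And>x. x \<in> S \<Longrightarrow> (f has_real_derivative f' x) (at x)" and f': "Ck_on k S f'"
  shows "Ck_on (Suc k) S f"
proof (rule Ck_on_SucI[OF S])
  show "(f has_derivative (*) (f' x)) (at x)" if "x \<in> S" for x
    using f[OF that] by (simp add: has_field_derivative_def)
  show "Ck_on k S (\<lambda>x. f' x * v)" for v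
    by (rule Ck_on_bilinear[OF bounded_bilinear_mult S f' Ck_on_const[OF S]])
qed

text \<open>The derivative is a polynomial in \<open>inverse\<close> itself, so the induction on the
  order closes. For \<open>sqrt\<close> below, the derivative is a multiple of
  \<open>inverse\<close> composed with \<open>sqrt\<close>, and the same scheme works.\<close>

lemma smooth_on_inverse: "smooth_on (- {0}) (inverse :: real \<Rightarrow> real)"
proof -
  have "Ck_on k (- {0}) (inverse :: real \<Rightarrow> real)" for k
  proof (induction k)
    case 0
    then show ?case by (auto intro!: continuous_intros)
  next
    case (Suc k)
    show ?case
    proof (rule Ck_on_real_SucI)
      show "(inverse has_real_derivative (- 1) * (inverse x * inverse x)) (at x)" if "x \<in> - {0}" for x :: real
        using that by (auto intro!: derivative_eq_intros simp: field_simps)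
      show "Ck_on k (- {0}) (\<lambda>x::real. (- 1) * (inverse x * inverse x))"
        by (intro Ck_on_bilinear[OF bounded_bilinear_mult] Ck_on_const Suc) auto
    qed auto
  qed
  then show ?thesis by (simp add: smooth_on_def)
qed

lemma smooth_on_sqrt: "smooth_on {0<..} sqrt"
proof -
  have "Ck_on k {0<..} sqrt" for k
  proof (induction k)
    case 0
    then show ?case by (auto intro!: continuous_intros)
  next
    case (Suc k)
    show ?case
    proof (rule Ck_on_real_SucI)
      show "(sqrt has_real_derivative (1 / 2) * inverse (sqrt x)) (at x)" if "x \<in> {0<..}" for x :: real
        using that by (auto intro!: derivative_eq_intros simp: field_simps)
      have "Ck_on k {0<..} (\<lambda>x. inverse (sqrt x))"
        by (rule Ck_on_compose[OF _ _ _ Suc, where T = "- {0}"])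
          (use smooth_on_inverse in \<open>auto simp: smooth_on_def\<close>)
      then show "Ck_on k {0<..} (\<lambda>x::real. (1 / 2) * inverse (sqrt x))"
        by (intro Ck_on_bilinear[OF bounded_bilinear_mult] Ck_on_const) auto
    qed auto
  qed
  then show ?thesis by (simp add: smooth_on_def)
qed

text \<open>The index makes the family closed under differentiation up to linear combinations;
  \<open>n = 0\<close> is the classical flat function exp(-1/x).\<close>

definition flat_exp :: "nat \<Rightarrow> real \<Rightarrow> real" where
  "flat_exp n x = (if x > 0 then exp (- (1 / x)) / x ^ n else 0)"

lemma flat_exp_tendsto_0: "(flat_exp n \<longlongrightarrow> 0) (at 0)"
proof -
  have r: "((\<lambda>x::real. exp (- (1 / x)) / x ^ n) \<longlongrightarrow> 0) (at_right 0)"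
  proof -
    \<comment> \<open>The substitution y = 1/x turns flatness at 0 into the domination of powers by
      the exponential at infinity.\<close>
    have "((\<lambda>y::real. y ^ n / exp y) \<longlongrightarrow> 0) at_top" by (rule tendsto_power_div_exp_0)
    then have "((\<lambda>x::real. inverse x ^ n / exp (inverse x)) \<longlongrightarrow> 0) (at_right 0)"
      by (rule filterlim_compose[OF _ filterlim_inverse_at_top_right])
    then show ?thesis
      by (simp add: exp_minus field_simps)
  qed
  have "(flat_exp n \<longlongrightarrow> 0) (at_right 0)"
    by (rule Lim_transform_eventually[OF r])
      (auto simp: eventually_at_right_less flat_exp_def eventually_at_filter)
  moreover have "(flat_exp n \<longlongrightarrow> 0) (at_left 0)"
    by (rule tendsto_eventually) (auto simp: flat_exp_def eventually_at_filter)
  ultimately show ?thesis by (simp add: filterlim_split_at)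
qed

lemma flat_exp_has_derivative:
  "(flat_exp n has_real_derivative (flat_exp (n + 2) x - real n * flat_exp (n + 1) x)) (at x)"
proof -
  consider "x > 0" | "x < 0" | "x = 0" by linarith
  then show ?thesis
  proof cases
    case 1
    have "((\<lambda>x. exp (- (1 / x)) / x ^ n) has_real_derivative
        (flat_exp (n + 2) x - real n * flat_exp (n + 1) x)) (at x)"
    proof -
      have e: "((\<lambda>x. exp (- (1 / x))) has_real_derivative exp (- (1 / x)) / x\<^sup>2) (at x)"
        using 1 by (auto intro!: derivative_eq_intros simp: power2_eq_square)
      have p: "((\<lambda>x. x ^ n) has_real_derivative real n * x ^ (n - 1)) (at x)"
        using DERIV_pow[of n x] by simp
      have "(exp (- (1 / x)) / x\<^sup>2 * x ^ n - exp (- (1 / x)) * (real n * x ^ (n - 1))) / (x ^ n * x ^ n) =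
          flat_exp (n + 2) x - real n * flat_exp (n + 1) x"
        using 1 by (cases n) (simp_all add: flat_exp_def diff_divide_distrib power2_eq_square)
      then show ?thesis
        using DERIV_divide[OF e p] 1 by simp
    qed
    then show ?thesis
      by (rule has_field_derivative_transform_within_open[where S = "{0<..}"])
        (use 1 in \<open>auto simp: flat_exp_def\<close>)
  next
    case 2
    have "((\<lambda>x. 0) has_real_derivative (flat_exp (n + 2) x - real n * flat_exp (n + 1) x)) (at x)"
      using 2 by (simp add: flat_exp_def)
    then show ?thesis
      by (rule has_field_derivative_transform_within_open[where S = "{..<0}"])
        (use 2 in \<open>auto simp: flat_exp_def\<close>)
  next
    case 3
    \<comment> \<open>At the origin the difference quotient is again a member of the family, so the
      limit at 0 gives the derivative.\<close>
    have "flat_exp n h / h = flat_exp (n + 1) h" for h by (auto simp: flat_exp_def)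
    moreover have "flat_exp m 0 = 0" for m by (simp add: flat_exp_def)
    ultimately show ?thesis
      using flat_exp_tendsto_0[of "n + 1"] 3 by (simp add: DERIV_def)
  qed
qed

lemma smooth_on_flat_exp: "smooth_on UNIV (flat_exp n)"
proof -
  have "Ck_on k UNIV (flat_exp n)" for k
  proof (induction k arbitrary: n)
    case 0
    then show ?case
      by (auto intro!: continuous_at_imp_continuous_on DERIV_isCont[OF flat_exp_has_derivative])
  next
    case (Suc k)
    have *: "Ck_on k UNIV (\<lambda>x. flat_exp (n + 2) x + (- real n) * flat_exp (n + 1) x)"
      by (intro Ck_on_add Ck_on_bilinear[OF bounded_bilinear_mult] Ck_on_const Suc) auto
    show ?case
      by (rule Ck_on_real_SucI[OF open_UNIV _ *]) (use flat_exp_has_derivative[of n] in simp)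
  qed
  then show ?thesis by (simp add: smooth_on_def)
qed

lemma smooth_cutoff:
  fixes c :: "'e::euclidean_space"
  assumes "0 < r"
  obtains h :: "'e \<Rightarrow> real" where "smooth_on UNIV h"
    "\<And>x. dist x c \<le> r / 2 \<Longrightarrow> h x = 1" "\<And>x. r \<le> dist x c \<Longrightarrow> h x = 0"
proof -
  define u where "u x = (x - c) \<bullet> (x - c)" for x
  define a where "a x = flat_exp 0 (r\<^sup>2 - u x)" for x
  define b where "b x = flat_exp 0 (u x - (r / 2)\<^sup>2)" for x
  have u: "smooth_on UNIV u"
    unfolding u_def
    by (intro smooth_on_bilinear[OF bounded_bilinear_inner] smooth_on_diff smooth_on_ident smooth_on_const) auto
  have udist: "u x = (dist x c)\<^sup>2" for x
    by (simp add: u_def dist_norm power2_norm_eq_inner)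
  have a: "smooth_on UNIV a" unfolding a_def
    by (rule smooth_on_compose[OF _ _ _ _ smooth_on_flat_exp]) (auto intro!: smooth_on_diff smooth_on_const u)
  have b: "smooth_on UNIV b" unfolding b_def
    by (rule smooth_on_compose[OF _ _ _ _ smooth_on_flat_exp]) (auto intro!: smooth_on_diff smooth_on_const u)
  \<comment> \<open>The cutoff is \<open>a / (a + b)\<close>: \<open>a\<close> vanishes from radius
    \<open>r\<close> outwards, \<open>b\<close> up to radius \<open>r / 2\<close>, and since
    \<open>r / 2 < r\<close> they never vanish together. The squared distance \<open>u\<close> is
    used because it is smooth at the centre too.\<close>
  have "(r / 2)\<^sup>2 < r\<^sup>2" using assms by (simp add: power2_eq_square)
  then have pos: "a x + b x > 0" for x
    unfolding a_def b_def flat_exp_def by (auto simp: add_pos_nonneg add_nonneg_pos)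
  have "smooth_on UNIV (\<lambda>x. inverse (a x + b x))"
    by (rule smooth_on_compose[OF _ _ _ smooth_on_add[OF _ a b] smooth_on_inverse])
      (use pos in \<open>auto simp: less_imp_neq[symmetric] dest: spec\<close>)
  then have "smooth_on UNIV (\<lambda>x. a x * inverse (a x + b x))"
    by (intro smooth_on_mult a) auto
  moreover have "a x * inverse (a x + b x) = 1" if "dist x c \<le> r / 2" for x
  proof -
    have "(dist x c)\<^sup>2 \<le> (r / 2)\<^sup>2" using that by (intro power_mono) auto
    then have "b x = 0" by (simp add: b_def udist flat_exp_def)
    then show ?thesis using pos[of x] by simp
  qed
  moreover have "a x * inverse (a x + b x) = 0" if "r \<le> dist x c" for x
  proof -
    have "r\<^sup>2 \<le> (dist x c)\<^sup>2" using that assms by (intro power_mono) auto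
    then show ?thesis by (simp add: a_def udist flat_exp_def)
  qed
  ultimately show ?thesis using that by blast
qed

section \<open>Smooth functions on manifolds\<close>

locale smooth_3manifold =
  fixes A :: "('a::{t2_space, second_countable_topology}) chart set"
  assumes atlas: "smooth_atlas A"
begin

lemma chart_exists: obtains D \<phi> where "(D, \<phi>) \<in> A" "p \<in> D"
proof -
  have "p \<in> (\<Union>(D, \<phi>)\<in>A. D)"
    using atlas[unfolded smooth_atlas_def, THEN conjunct1] by simp
  then show ?thesis using that by auto
qed

lemma chart_homeo:
  assumes "(D, \<phi>) \<in> A"
  shows "open D \<and> open (\<phi> ` D) \<and> homeomorphism D (\<phi> ` D) \<phi> (inv_into D \<phi>)"
  using bspec[OF atlas[unfolded smooth_atlas_def, THEN conjunct2, THEN conjunct1] assms] by simp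

lemmas chart_open = chart_homeo[THEN conjunct1]
  and chart_homeomorphism = chart_homeo[THEN conjunct2, THEN conjunct2]

lemma chart_transition:
  assumes "(D, \<phi>) \<in> A" "(E, \<psi>) \<in> A"
  shows "smooth_on (\<phi> ` (D \<inter> E)) (\<psi> \<circ> inv_into D \<phi>)"
  using bspec[OF bspec[OF atlas[unfolded smooth_atlas_def, THEN conjunct2, THEN conjunct2] assms(1),
      unfolded prod.case] assms(2)] by simp

lemma chart_inverse: "(D, \<phi>) \<in> A \<Longrightarrow> q \<in> D \<Longrightarrow> inv_into D \<phi> (\<phi> q) = q"
  using chart_homeomorphism homeomorphism_apply1 by blast

lemma chart_continuous: "(D, \<phi>) \<in> A \<Longrightarrow> continuous_on D \<phi>"
  using chart_homeomorphism homeomorphism_cont1 by blast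

lemma chart_image_open:
  assumes "(D, \<phi>) \<in> A" "open U"
  shows "open (\<phi> ` (D \<inter> U))"
proof -
  have "openin (top_of_set (\<phi> ` D)) (\<phi> ` (D \<inter> U))"
    by (rule homeomorphism_imp_open_map[OF chart_homeomorphism[OF assms(1)]])
      (use assms(2) in \<open>auto simp: openin_open\<close>)
  moreover have "open (\<phi> ` D)"
    using chart_homeo[OF assms(1)] by blast
  ultimately show ?thesis using openin_open_trans by blast
qed

lemma chart_preimage_open:
  assumes "(D, \<phi>) \<in> A" "open T"
  shows "open (D \<inter> \<phi> -` T)"
  using continuous_open_preimage[OF chart_continuous[OF assms(1)] chart_open[OF assms(1)] assms(2)] .

lemma smooth_fun_subset: "smooth_fun A U f \<Longrightarrow> W \<subseteq> U \<Longrightarrow> smooth_fun A W f"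
  unfolding smooth_fun_def by (blast intro: smooth_on_subset)

lemma smooth_nearE:
  assumes "smooth_near A p f"
  obtains U where "open U" "p \<in> U" "smooth_fun A U f"
  using assms unfolding smooth_near_def by blast

text \<open>Smoothness is local. This passage from sets to germs allows all later arguments to be
  made at a single point.\<close>

lemma smooth_fun_iff_near:
  assumes U: "open U"
  shows "smooth_fun A U f \<longleftrightarrow> (\<forall>p\<in>U. smooth_near A p f)"
proof
  assume "smooth_fun A U f"
  then show "\<forall>p\<in>U. smooth_near A p f" using U unfolding smooth_near_def by blast
next
  assume near: "\<forall>p\<in>U. smooth_near A p f"
  have "smooth_on (\<phi> ` (D \<inter> U)) (f \<circ> inv_into D \<phi>)" if c: "(D, \<phi>) \<in> A" for D \<phi>
  proof (rule smooth_on_local)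
    fix x assume "x \<in> \<phi> ` (D \<inter> U)"
    then obtain p where p: "p \<in> D" "p \<in> U" "x = \<phi> p" by blast
    obtain W where W: "open W" "p \<in> W" "smooth_fun A W f"
      using near p(2) smooth_nearE by blast
    have "smooth_on (\<phi> ` (D \<inter> W)) (f \<circ> inv_into D \<phi>)"
      using W(3) c unfolding smooth_fun_def by blast
    then show "\<exists>T. open T \<and> x \<in> T \<and> smooth_on T (f \<circ> inv_into D \<phi>)"
      using chart_image_open[OF c W(1)] p W(2) by blast
  qed
  then show "smooth_fun A U f" unfolding smooth_fun_def by blast
qed

lemma smooth_fun_UNIV: "smooth_fun A UNIV f \<longleftrightarrow> (\<forall>p. smooth_near A p f)"
  by (simp add: smooth_fun_iff_near)

lemma smooth_near_eventually:
  assumes "smooth_near A p f"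
  shows "\<forall>\<^sub>F q in nhds p. smooth_near A q f"
proof -
  obtain U where U: "open U" "p \<in> U" "smooth_fun A U f" using assms smooth_nearE by blast
  then show ?thesis using smooth_fun_iff_near[OF U(1), of f] unfolding eventually_nhds by blast
qed

text \<open>A common transfer from Euclidean space for sums, differences and products: both
  functions are read in a chart over the intersection of their domains.\<close>

lemma smooth_near_lift2:
  fixes F :: "real \<Rightarrow> real \<Rightarrow> real"
  assumes F: "\<And>(S :: (real ^ 3) set) u v. open S \<Longrightarrow> smooth_on S u \<Longrightarrow> smooth_on S v \<Longrightarrow>
      smooth_on S (\<lambda>x. F (u x) (v x))"
    and "smooth_near A p f" "smooth_near A p g"
  shows "smooth_near A p (\<lambda>q. F (f q) (g q))"
proof -
  obtain U where U: "open U" "p \<in> U" "smooth_fun A U f" using assms(2) smooth_nearE by blast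
  obtain V where V: "open V" "p \<in> V" "smooth_fun A V g" using assms(3) smooth_nearE by blast
  have "smooth_on (\<phi> ` (D \<inter> (U \<inter> V))) ((\<lambda>q. F (f q) (g q)) \<circ> inv_into D \<phi>)" if c: "(D, \<phi>) \<in> A" for D \<phi>
  proof -
    have "smooth_on (\<phi> ` (D \<inter> (U \<inter> V))) (f \<circ> inv_into D \<phi>)"
      by (rule smooth_on_subset[of "\<phi> ` (D \<inter> U)"]) (use U(3) c in \<open>auto simp: smooth_fun_def\<close>)
    moreover have "smooth_on (\<phi> ` (D \<inter> (U \<inter> V))) (g \<circ> inv_into D \<phi>)"
      by (rule smooth_on_subset[of "\<phi> ` (D \<inter> V)"]) (use V(3) c in \<open>auto simp: smooth_fun_def\<close>)
    moreover have "open (\<phi> ` (D \<inter> (U \<inter> V)))"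
      using chart_image_open[OF c] U(1) V(1) by blast
    ultimately show ?thesis using F[of _ "f \<circ> inv_into D \<phi>" "g \<circ> inv_into D \<phi>"] by (simp add: o_def)
  qed
  then have "smooth_fun A (U \<inter> V) (\<lambda>q. F (f q) (g q))" unfolding smooth_fun_def by blast
  then show ?thesis using U(1,2) V(1,2) unfolding smooth_near_def by blast
qed

lemma smooth_near_add: "smooth_near A p f \<Longrightarrow> smooth_near A p g \<Longrightarrow> smooth_near A p (\<lambda>q. f q + g q)"
  by (rule smooth_near_lift2[OF smooth_on_add])

lemma smooth_near_diff: "smooth_near A p f \<Longrightarrow> smooth_near A p g \<Longrightarrow> smooth_near A p (\<lambda>q. f q - g q)"
  by (rule smooth_near_lift2[OF smooth_on_diff])

lemma smooth_near_mult: "smooth_near A p f \<Longrightarrow> smooth_near A p g \<Longrightarrow> smooth_near A p (\<lambda>q. f q * g q)"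
  by (rule smooth_near_lift2[OF smooth_on_mult])

lemma smooth_near_const: "smooth_near A p (\<lambda>q. c)"
proof -
  have "smooth_fun A UNIV (\<lambda>q. c)"
    unfolding smooth_fun_def using smooth_on_const[OF chart_image_open[OF _ open_UNIV]] by (auto simp: o_def)
  then show ?thesis unfolding smooth_near_def by blast
qed

lemma smooth_near_cong:
  assumes f: "smooth_near A p f" and eq: "\<forall>\<^sub>F q in nhds p. f q = g q"
  shows "smooth_near A p g"
proof -
  obtain U where U: "open U" "p \<in> U" "smooth_fun A U f" using f smooth_nearE by blast
  obtain V where V: "open V" "p \<in> V" "\<And>q. q \<in> V \<Longrightarrow> f q = g q"
    using eq unfolding eventually_nhds by blast
  have "smooth_on (\<phi> ` (D \<inter> (U \<inter> V))) (g \<circ> inv_into D \<phi>)" if c: "(D, \<phi>) \<in> A" for D \<phi>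
  proof (rule smooth_on_cong)
    show "open (\<phi> ` (D \<inter> (U \<inter> V)))"
      using chart_image_open[OF c] U(1) V(1) by blast
    show "smooth_on (\<phi> ` (D \<inter> (U \<inter> V))) (f \<circ> inv_into D \<phi>)"
      by (rule smooth_on_subset[of "\<phi> ` (D \<inter> U)"]) (use U(3) c in \<open>auto simp: smooth_fun_def\<close>)
    show "(f \<circ> inv_into D \<phi>) x = (g \<circ> inv_into D \<phi>) x" if "x \<in> \<phi> ` (D \<inter> (U \<inter> V))" for x
      using that V(3) chart_inverse[OF c] by auto
  qed
  then have "smooth_fun A (U \<inter> V) g" unfolding smooth_fun_def by blast
  then show ?thesis using U(1,2) V(1,2) unfolding smooth_near_def by blast
qed

lemma smooth_fun_continuous_on:
  assumes U: "open U" and f: "smooth_fun A U f"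
  shows "continuous_on U f"
proof (rule continuous_at_imp_continuous_on, rule ballI)
  fix p assume p: "p \<in> U"
  obtain D \<phi> where c: "(D, \<phi>) \<in> A" "p \<in> D" using chart_exists .
  have 1: "continuous_on (\<phi> ` (D \<inter> U)) (f \<circ> inv_into D \<phi>)"
    using f c(1) smooth_on_imp_continuous_on unfolding smooth_fun_def by blast
  have 2: "continuous_on (D \<inter> U) \<phi>"
    by (rule continuous_on_subset[OF chart_continuous[OF c(1)]]) auto
  have "continuous_on (D \<inter> U) ((f \<circ> inv_into D \<phi>) \<circ> \<phi>)"
    by (rule continuous_on_compose[OF 2 1])
  then have "continuous_on (D \<inter> U) f"
    by (rule continuous_on_eq) (simp add: chart_inverse[OF c(1)])
  then show "isCont f p"
    using p c chart_open[OF c(1)] U by (simp add: continuous_on_eq_continuous_at open_Int)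
qed

lemma smooth_near_compose:
  fixes b :: "real \<Rightarrow> real"
  assumes f: "smooth_near A p f" and b: "smooth_on T b" and T: "open T" "f p \<in> T"
  shows "smooth_near A p (\<lambda>q. b (f q))"
proof -
  obtain U where U: "open U" "p \<in> U" "smooth_fun A U f" using f smooth_nearE by blast
  \<comment> \<open>The outer function is smooth only on \<open>T\<close>; continuity of
    \<open>f\<close> makes the part of \<open>U\<close> that is mapped into \<open>T\<close> an open
    neighbourhood of \<open>p\<close>.\<close>
  define W where "W = U \<inter> f -` T"
  have W: "open W" "p \<in> W" "W \<subseteq> U" unfolding W_def
    using continuous_open_preimage[OF smooth_fun_continuous_on U(1)] U T by auto
  have "smooth_on (\<phi> ` (D \<inter> W)) ((\<lambda>q. b (f q)) \<circ> inv_into D \<phi>)" if c: "(D, \<phi>) \<in> A" for D \<phi>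
  proof -
    have 1: "smooth_on (\<phi> ` (D \<inter> W)) (f \<circ> inv_into D \<phi>)"
      by (rule smooth_on_subset[of "\<phi> ` (D \<inter> U)"]) (use U(3) c W(3) in \<open>auto simp: smooth_fun_def\<close>)
    have 2: "(f \<circ> inv_into D \<phi>) ` \<phi> ` (D \<inter> W) \<subseteq> T"
      using chart_inverse[OF c] by (auto simp: W_def)
    show ?thesis
      using smooth_on_compose[OF chart_image_open[OF c W(1)] T(1) 2 1 b] by (simp add: o_def)
  qed
  then have "smooth_fun A W (\<lambda>q. b (f q))" unfolding smooth_fun_def by blast
  then show ?thesis using W(1,2) unfolding smooth_near_def by blast
qed

lemma smooth_near_inverse: "smooth_near A p f \<Longrightarrow> f p \<noteq> 0 \<Longrightarrow> smooth_near A p (\<lambda>q. inverse (f q))"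
  by (rule smooth_near_compose[OF _ smooth_on_inverse]) auto

lemma smooth_near_divide:
  "smooth_near A p f \<Longrightarrow> smooth_near A p g \<Longrightarrow> g p \<noteq> 0 \<Longrightarrow> smooth_near A p (\<lambda>q. f q / g q)"
  by (simp add: divide_inverse smooth_near_mult smooth_near_inverse)

lemma smooth_near_sqrt: "smooth_near A p f \<Longrightarrow> f p > 0 \<Longrightarrow> smooth_near A p (\<lambda>q. sqrt (f q))"
  by (rule smooth_near_compose[OF _ smooth_on_sqrt]) auto

lemma smooth_near_chart:
  fixes b :: "real ^ 3 \<Rightarrow> real"
  assumes c: "(D, \<phi>) \<in> A" "p \<in> D" and b: "smooth_on T b" and T: "open T" "\<phi> p \<in> T"
  shows "smooth_near A p (\<lambda>q. b (\<phi> q))"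
proof -
  define W where "W = D \<inter> \<phi> -` T"
  have W: "open W" "p \<in> W" using chart_preimage_open[OF c(1) T(1)] c T by (auto simp: W_def)
  have "smooth_on (\<psi> ` (E \<inter> W)) ((\<lambda>q. b (\<phi> q)) \<circ> inv_into E \<psi>)" if e: "(E, \<psi>) \<in> A" for E \<psi>
  proof -
    have 1: "smooth_on (\<psi> ` (E \<inter> W)) (\<phi> \<circ> inv_into E \<psi>)"
      by (rule smooth_on_subset[OF chart_transition[OF e c(1)]]) (auto simp: W_def)
    have 2: "(\<phi> \<circ> inv_into E \<psi>) ` \<psi> ` (E \<inter> W) \<subseteq> T"
      using chart_inverse[OF e] by (auto simp: W_def)
    show ?thesis
      using smooth_on_compose[OF chart_image_open[OF e W(1)] T(1) 2 1 b] by (simp add: o_def)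
  qed
  then have "smooth_fun A W (\<lambda>q. b (\<phi> q))" unfolding smooth_fun_def by blast
  then show ?thesis using W unfolding smooth_near_def by blast
qed

text \<open>The closed set \<open>K\<close> is recorded in the statement because its complement is
  an open set covering every point outside \<open>U\<close>. A product with \<open>h\<close>,
  extended by zero beyond \<open>U\<close>, is therefore zero near such points and smooth
  there.\<close>

lemma bump_function:
  assumes U: "open U" "p \<in> U"
  obtains h K where "smooth_fun A UNIV h" "closed K" "K \<subseteq> U" "\<And>q. q \<notin> K \<Longrightarrow> h q = 0"
    "\<forall>\<^sub>F q in nhds p. h q = 1"
proof -
  obtain D \<phi> where c: "(D, \<phi>) \<in> A" "p \<in> D" using chart_exists .
  have "open (\<phi> ` (D \<inter> U))" by (rule chart_image_open[OF c(1) U(1)])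
  then obtain r where r: "0 < r" "cball (\<phi> p) r \<subseteq> \<phi> ` (D \<inter> U)"
    using c U open_contains_cball by blast
  obtain b :: "real ^ 3 \<Rightarrow> real" where b: "smooth_on UNIV b"
    "\<And>x. dist x (\<phi> p) \<le> r / 2 \<Longrightarrow> b x = 1" "\<And>x. r \<le> dist x (\<phi> p) \<Longrightarrow> b x = 0"
    using smooth_cutoff[OF r(1), of "\<phi> p"] by blast
  \<comment> \<open>A compact image, hence closed in the Hausdorff manifold. The ball lies in the
    image of \<open>D \<inter> U\<close>, so extending by zero outside the chart domain creates no
    singularity.\<close>
  define K where "K = inv_into D \<phi> ` cball (\<phi> p) r"
  define h where "h q = (if q \<in> D then b (\<phi> q) else 0)" for q
  have "continuous_on (cball (\<phi> p) r) (inv_into D \<phi>)"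
    by (rule continuous_on_subset[OF homeomorphism_cont2[OF chart_homeomorphism[OF c(1)]]]) (use r(2) in blast)
  then have K: "closed K"
    unfolding K_def by (intro compact_imp_closed compact_continuous_image compact_cball)
  have KU: "K \<subseteq> D \<inter> U"
    unfolding K_def using r(2) chart_inverse[OF c(1)] by fastforce
  have h0: "h q = 0" if "q \<notin> K" for q
  proof (cases "q \<in> D")
    case True
    then have "\<phi> q \<notin> cball (\<phi> p) r"
      using that chart_inverse[OF c(1) True] unfolding K_def by (metis imageI)
    then show ?thesis using b(3)[of "\<phi> q"] by (simp add: h_def dist_commute)
  qed (simp add: h_def)
  have "smooth_near A q h" for q
  proof (cases "q \<in> D")
    case True
    show ?thesis
      by (rule smooth_near_cong[OF smooth_near_chart[OF c(1) True b(1)]])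
        (use True chart_open[OF c(1)] in \<open>auto simp: eventually_nhds h_def\<close>)
  next
    case False
    show ?thesis
      by (rule smooth_near_cong[OF smooth_near_const[of _ 0]])
        (use False K KU h0 in \<open>auto simp: eventually_nhds intro!: exI[of _ "- K"]\<close>)
  qed
  moreover have "\<forall>\<^sub>F q in nhds p. h q = 1"
    unfolding eventually_nhds
  proof (intro exI conjI ballI)
    show "open (D \<inter> \<phi> -` ball (\<phi> p) (r / 2))" by (rule chart_preimage_open[OF c(1) open_ball])
    show "p \<in> D \<inter> \<phi> -` ball (\<phi> p) (r / 2)" using c r by simp
    show "h q = 1" if "q \<in> D \<inter> \<phi> -` ball (\<phi> p) (r / 2)" for q
      using that b(2)[of "\<phi> q"] by (simp add: h_def dist_commute)
  qed
  ultimately show ?thesis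
    by (intro that[OF _ K _ h0]) (use KU in \<open>simp_all add: smooth_fun_UNIV\<close>)
qed

lemma extend_fun:
  assumes f: "smooth_near A p f"
  obtains F where "smooth_fun A UNIV F" "\<forall>\<^sub>F q in nhds p. F q = f q"
proof -
  obtain U where U: "open U" "p \<in> U" "smooth_fun A U f" using f smooth_nearE by blast
  obtain h K where h: "smooth_fun A UNIV h" "closed K" "K \<subseteq> U" "\<And>q. q \<notin> K \<Longrightarrow> h q = 0"
    "\<forall>\<^sub>F q in nhds p. h q = 1"
    using bump_function[OF U(1,2)] by blast
  have "smooth_near A q (\<lambda>q. if q \<in> U then h q * f q else 0)" for q
  proof (cases "q \<in> U")
    case True
    have "smooth_near A q (\<lambda>q. h q * f q)"
      using h(1) U True by (intro smooth_near_mult) (auto simp: smooth_fun_iff_near)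
    then show ?thesis
      by (rule smooth_near_cong) (use True U(1) in \<open>auto simp: eventually_nhds\<close>)
  next
    case False
    show ?thesis
      by (rule smooth_near_cong[OF smooth_near_const[of _ 0]])
        (use False h in \<open>auto simp: eventually_nhds intro!: exI[of _ "- K"]\<close>)
  qed
  moreover have "\<forall>\<^sub>F q in nhds p. (if q \<in> U then h q * f q else 0) = f q"
    using h(5) eventually_nhds_in_open[OF U(1,2)] by eventually_elim simp
  ultimately show ?thesis
    by (intro that[of "\<lambda>q. if q \<in> U then h q * f q else 0"]) (simp_all add: smooth_fun_UNIV)
qed

section \<open>Tangent vectors and vector fields\<close>

lemma tangent_nonsmooth: "v \<in> tangent_space A p \<Longrightarrow> \<not> smooth_near A p f \<Longrightarrow> v f = 0"
  by (auto simp: tangent_space_def)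

lemma tangentD:
  assumes "v \<in> tangent_space A p" "smooth_near A p f" "smooth_near A p g"
  shows "((\<forall>\<^sub>F q in nhds p. f q = g q) \<longrightarrow> v f = v g) \<and>
    (\<forall>a b. v (\<lambda>q. a * f q + b * g q) = a * v f + b * v g) \<and>
    v (\<lambda>q. f q * g q) = f p * v g + v f * g p"
  by (rule mp[OF assms(1)[unfolded tangent_space_def mem_Collect_eq, THEN conjunct2,
        THEN spec, THEN spec] conjI[OF assms(2,3)]])

lemma tangent_cong:
  assumes "v \<in> tangent_space A p" "smooth_near A p f" "\<forall>\<^sub>F q in nhds p. f q = g q"
  shows "v f = v g"
  using tangentD[OF assms(1,2) smooth_near_cong[OF assms(2,3)]] assms(3) by (elim conjE mp)

lemma tangent_mult:
  assumes "v \<in> tangent_space A p" "smooth_near A p f" "smooth_near A p g"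
  shows "v (\<lambda>q. f q * g q) = f p * v g + v f * g p"
  using tangentD[OF assms] by (elim conjE)

lemma tangent_linear:
  assumes "v \<in> tangent_space A p" "smooth_near A p f" "smooth_near A p g"
  shows "v (\<lambda>q. a * f q + b * g q) = a * v f + b * v g"
  using tangentD[OF assms] by (elim conjE allE)

lemma tangent_add:
  "v \<in> tangent_space A p \<Longrightarrow> smooth_near A p f \<Longrightarrow> smooth_near A p g \<Longrightarrow>
    v (\<lambda>q. f q + g q) = v f + v g"
  using tangent_linear[of v p f g 1 1] by simp

lemma tangent_diff:
  "v \<in> tangent_space A p \<Longrightarrow> smooth_near A p f \<Longrightarrow> smooth_near A p g \<Longrightarrow>
    v (\<lambda>q. f q - g q) = v f - v g"
  using tangent_linear[of v p f g 1 "-1"] by simp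

lemma tangent_const:
  assumes "v \<in> tangent_space A p"
  shows "v (\<lambda>q. c) = 0"
proof -
  have "v (\<lambda>q. 1 * 1) = 1 * v (\<lambda>q. 1) + v (\<lambda>q. 1) * 1"
    by (rule tangent_mult[OF assms smooth_near_const smooth_near_const])
  then have "v (\<lambda>q. 1) = 0" by simp
  then show ?thesis
    using tangent_linear[OF assms smooth_near_const[of _ 1] smooth_near_const[of _ 1], of c 0] by simp
qed

lemma tangent_subspace: "tv.subspace (tangent_space A p)"
proof (rule tv.subspaceI)
  show "0 \<in> tangent_space A p" by (simp add: tangent_space_def zero_fun_def)
next
  fix v w assume v: "v \<in> tangent_space A p" and w: "w \<in> tangent_space A p"
  show "v + w \<in> tangent_space A p"
    unfolding tangent_space_def mem_Collect_eq
  proof (intro conjI allI impI; (elim conjE)?)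
    fix f g assume f: "smooth_near A p f" and g: "smooth_near A p g"
    show "(v + w) f = (v + w) g" if "\<forall>\<^sub>F q in nhds p. f q = g q"
      using tangent_cong[OF v f that] tangent_cong[OF w f that] by simp
    show "(v + w) (\<lambda>q. a * f q + b * g q) = a * (v + w) f + b * (v + w) g" for a b
      using tangent_linear[OF v f g] tangent_linear[OF w f g] by (simp add: algebra_simps)
    show "(v + w) (\<lambda>q. f q * g q) = f p * (v + w) g + (v + w) f * g p"
      using tangent_mult[OF v f g] tangent_mult[OF w f g] by (simp add: algebra_simps)
  qed (simp add: tangent_nonsmooth[OF v] tangent_nonsmooth[OF w])
next
  fix c v assume v: "v \<in> tangent_space A p"
  show "tscale c v \<in> tangent_space A p"
    unfolding tangent_space_def mem_Collect_eq tscale_def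
  proof (intro conjI allI impI; (elim conjE)?)
    fix f g assume f: "smooth_near A p f" and g: "smooth_near A p g"
    show "c * v f = c * v g" if "\<forall>\<^sub>F q in nhds p. f q = g q"
      using tangent_cong[OF v f that] by simp
    show "c * v (\<lambda>q. a * f q + b * g q) = a * (c * v f) + b * (c * v g)" for a b
      using tangent_linear[OF v f g] by (simp add: algebra_simps)
    show "c * v (\<lambda>q. f q * g q) = f p * (c * v g) + c * v f * g p"
      using tangent_mult[OF v f g] by (simp add: algebra_simps)
  qed (simp add: tangent_nonsmooth[OF v])
qed

lemmas tangent_plus = tv.subspace_add[OF tangent_subspace]
  and tangent_scale = tv.subspace_scale[OF tangent_subspace]
  and tangent_minus = tv.subspace_diff[OF tangent_subspace]
  and tangent_zero = tv.subspace_0[OF tangent_subspace]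

text \<open>The germ version of membership in \<open>vfields\<close>. It permits different arguments
  at different points, as when a field is extended by zero.\<close>

definition vfield_near :: "'a vfield \<Rightarrow> 'a \<Rightarrow> bool" where
  "vfield_near V p \<longleftrightarrow> V p \<in> tangent_space A p \<and>
     (\<forall>f. smooth_near A p f \<longrightarrow> smooth_near A p (\<lambda>q. V q f))"

lemma vfields_iff:
  assumes U: "open U"
  shows "V \<in> vfields A U \<longleftrightarrow> (\<forall>p\<in>U. vfield_near V p)"
proof
  assume V: "V \<in> vfields A U"
  show "\<forall>p\<in>U. vfield_near V p"
    unfolding vfield_near_def
  proof (intro ballI conjI allI impI)
    fix p f assume p: "p \<in> U" and f: "smooth_near A p f"
    obtain W where W: "open W" "p \<in> W" "smooth_fun A W f" using f smooth_nearE by blast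
    have "smooth_fun A (W \<inter> U) (\<lambda>q. V q f)"
      using V W U smooth_fun_subset[OF W(3), of "W \<inter> U"] unfolding vfields_def by blast
    then show "smooth_near A p (\<lambda>q. V q f)"
      using U W p unfolding smooth_near_def by blast
  qed (use V in \<open>auto simp: vfields_def\<close>)
next
  assume near: "\<forall>p\<in>U. vfield_near V p"
  show "V \<in> vfields A U"
    unfolding vfields_def mem_Collect_eq
  proof (intro conjI allI impI)
    fix W f assume W: "open W \<and> W \<subseteq> U \<and> smooth_fun A W f"
    then have "smooth_near A p (\<lambda>p. V p f)" if "p \<in> W" for p
      using near that smooth_fun_iff_near[of W f] unfolding vfield_near_def by blast
    then show "smooth_fun A W (\<lambda>p. V p f)"
      using W smooth_fun_iff_near[of W "\<lambda>p. V p f"] by blast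
  qed (use near in \<open>auto simp: vfield_near_def\<close>)
qed

lemma vfields_tangent: "V \<in> vfields A U \<Longrightarrow> p \<in> U \<Longrightarrow> V p \<in> tangent_space A p"
  by (simp add: vfields_def)

lemma vfields_smooth:
  "V \<in> vfields A U \<Longrightarrow> open U \<Longrightarrow> p \<in> U \<Longrightarrow> smooth_near A p f \<Longrightarrow> smooth_near A p (\<lambda>q. V q f)"
  using vfields_iff vfield_near_def by blast

lemma vfields_smooth_fun:
  "V \<in> vfields A U \<Longrightarrow> open U \<Longrightarrow> smooth_fun A U f \<Longrightarrow> smooth_fun A U (\<lambda>q. V q f)"
  by (simp add: vfields_def)

lemma vfields_subset:
  assumes V: "V \<in> vfields A U" and W: "W \<subseteq> U"
  shows "V \<in> vfields A W"
  unfolding vfields_def mem_Collect_eq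
proof (intro conjI ballI allI impI)
  show "V p \<in> tangent_space A p" if "p \<in> W" for p
    using vfields_tangent[OF V] W that by blast
  show "smooth_fun A X (\<lambda>p. V p f)" if X: "open X \<and> X \<subseteq> W \<and> smooth_fun A X f" for X f
    using V X order_trans[OF _ W, of X] by (simp add: vfields_def)
qed

lemma vfield_near_cong:
  assumes "vfield_near V p" "\<forall>\<^sub>F q in nhds p. V q = W q"
  shows "vfield_near W p"
  unfolding vfield_near_def
proof (intro conjI allI impI)
  show "W p \<in> tangent_space A p"
    using assms eventually_nhds_x_imp_x[OF assms(2)] by (simp add: vfield_near_def)
  fix f assume "smooth_near A p f"
  then have "smooth_near A p (\<lambda>q. V q f)" using assms(1) by (simp add: vfield_near_def)
  then show "smooth_near A p (\<lambda>q. W q f)"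
    by (rule smooth_near_cong) (use assms(2) in \<open>auto elim: eventually_mono\<close>)
qed

lemma vfield_near_zero: "vfield_near (\<lambda>q. 0) p"
  unfolding vfield_near_def using tangent_zero smooth_near_const[of p 0] by simp

lemma vfields_fscale:
  assumes U: "open U" and "V \<in> vfields A U" "\<And>p. p \<in> U \<Longrightarrow> smooth_near A p f"
  shows "fscale f V \<in> vfields A U"
  using assms(2,3) unfolding vfields_iff[OF U] vfield_near_def fscale_def
  by (auto intro: tangent_scale) (simp add: tscale_def smooth_near_mult)

lemma vfields_add:
  assumes U: "open U" and "V \<in> vfields A U" "W \<in> vfields A U"
  shows "V + W \<in> vfields A U"
  using assms(2,3) unfolding vfields_iff[OF U] vfield_near_def
  by (auto intro: tangent_plus smooth_near_add)

lemma vfields_minus: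
  assumes U: "open U" and "V \<in> vfields A U" "W \<in> vfields A U"
  shows "V - W \<in> vfields A U"
  using assms(2,3) unfolding vfields_iff[OF U] vfield_near_def
  by (auto intro: tangent_minus smooth_near_diff)

lemma lie_bracket_vfields:
  assumes U: "open U" and V: "V \<in> vfields A U" and W: "W \<in> vfields A U"
  shows "lie_bracket A V W \<in> vfields A U"
  unfolding vfields_iff[OF U] vfield_near_def
proof (intro ballI conjI allI impI)
  fix p assume p: "p \<in> U"
  note Vp = vfields_tangent[OF V p] and Wp = vfields_tangent[OF W p]
  note Vs = vfields_smooth[OF V U p] and Ws = vfields_smooth[OF W U p]
  have nhU: "\<forall>\<^sub>F q in nhds p. q \<in> U" using eventually_nhds_in_open[OF U p] .
  show "lie_bracket A V W p \<in> tangent_space A p"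
    unfolding tangent_space_def mem_Collect_eq
  proof (intro conjI allI impI; (elim conjE)?)
    fix f g assume f: "smooth_near A p f" and g: "smooth_near A p g"
    have nh: "\<forall>\<^sub>F q in nhds p. q \<in> U \<and> smooth_near A q f \<and> smooth_near A q g"
      using nhU smooth_near_eventually[OF f] smooth_near_eventually[OF g] by eventually_elim simp
    show "lie_bracket A V W p f = lie_bracket A V W p g" if eq: "\<forall>\<^sub>F q in nhds p. f q = g q"
    proof -
      have ev: "\<forall>\<^sub>F q in nhds p. Y q f = Y q g" if "Y \<in> vfields A U" for Y
      proof -
        \<comment> \<open>Equality of the values \<open>f q\<close> and \<open>g q\<close> would not
          be enough: the inner field differentiates at \<open>q\<close>, so the germs must agree at
          each nearby point.\<close>
        have "\<forall>\<^sub>F q in nhds p. \<forall>\<^sub>F r in nhds q. f r = g r" using eq by (simp add: eventually_eventually)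
        then show ?thesis
          using nh by eventually_elim (use that vfields_tangent tangent_cong in blast)
      qed
      have "V p (\<lambda>q. W q f) = V p (\<lambda>q. W q g)" "W p (\<lambda>q. V q f) = W p (\<lambda>q. V q g)"
        using tangent_cong[OF Vp Ws[OF f] ev[OF W]] tangent_cong[OF Wp Vs[OF f] ev[OF V]] by auto
      then show ?thesis using f g by (simp add: lie_bracket_def)
    qed
    show "lie_bracket A V W p (\<lambda>q. a * f q + b * g q) = a * lie_bracket A V W p f + b * lie_bracket A V W p g"
      for a b
    proof -
      have s: "smooth_near A q (\<lambda>q. a * f q + b * g q)" if "smooth_near A q f" "smooth_near A q g" for q f g
        using that by (intro smooth_near_add smooth_near_mult smooth_near_const)
      have *: "Z p (\<lambda>q. Y q (\<lambda>q. a * f q + b * g q)) = a * Z p (\<lambda>q. Y q f) + b * Z p (\<lambda>q. Y q g)"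
        if Y: "Y \<in> vfields A U" and Z: "Z \<in> vfields A U" for Y Z
      proof -
        have "\<forall>\<^sub>F q in nhds p. Y q (\<lambda>q. a * f q + b * g q) = a * Y q f + b * Y q g"
          using nh by eventually_elim (use vfields_tangent[OF Y] tangent_linear in blast)
        then have "Z p (\<lambda>q. Y q (\<lambda>q. a * f q + b * g q)) = Z p (\<lambda>q. a * Y q f + b * Y q g)"
          by (rule tangent_cong[OF vfields_tangent[OF Z p] vfields_smooth[OF Y U p s[OF f g]]])
        then show ?thesis
          using tangent_linear[OF vfields_tangent[OF Z p] vfields_smooth[OF Y U p f] vfields_smooth[OF Y U p g]] by simp
      qed
      show ?thesis
        using *[OF W V] *[OF V W] f g s[OF f g] by (simp add: lie_bracket_def algebra_simps)
    qed
    show "lie_bracket A V W p (\<lambda>q. f q * g q) = f p * lie_bracket A V W p g + lie_bracket A V W p f * g p"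
    proof -
      \<comment> \<open>The two cross terms are symmetric in \<open>Y\<close> and \<open>Z\<close>.
        They cancel in the commutator, which makes the second-order operator a derivation.\<close>
      have *: "Z p (\<lambda>q. Y q (\<lambda>q. f q * g q)) =
          f p * Z p (\<lambda>q. Y q g) + Z p f * Y p g + Y p f * Z p g + Z p (\<lambda>q. Y q f) * g p"
        if Y: "Y \<in> vfields A U" and Z: "Z \<in> vfields A U" for Y Z
      proof -
        note Zp = vfields_tangent[OF Z p] and Yf = vfields_smooth[OF Y U p f] and Yg = vfields_smooth[OF Y U p g]
        have "\<forall>\<^sub>F q in nhds p. Y q (\<lambda>q. f q * g q) = f q * Y q g + Y q f * g q"
          using nh by eventually_elim (use vfields_tangent[OF Y] tangent_mult in blast)
        then have "Z p (\<lambda>q. Y q (\<lambda>q. f q * g q)) = Z p (\<lambda>q. f q * Y q g + Y q f * g q)"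
          by (rule tangent_cong[OF Zp vfields_smooth[OF Y U p smooth_near_mult[OF f g]]])
        then show ?thesis
          using tangent_add[OF Zp smooth_near_mult[OF f Yg] smooth_near_mult[OF Yf g]]
            tangent_mult[OF Zp f Yg] tangent_mult[OF Zp Yf g] by simp
      qed
      show ?thesis
        using *[OF W V] *[OF V W] f g smooth_near_mult[OF f g] by (simp add: lie_bracket_def algebra_simps)
    qed
  qed (simp add: lie_bracket_def)
  fix f assume f: "smooth_near A p f"
  have "smooth_near A p (\<lambda>q. V q (\<lambda>r. W r f) - W q (\<lambda>r. V r f))"
    using Vs Ws f by (intro smooth_near_diff) auto
  then show "smooth_near A p (\<lambda>q. lie_bracket A V W q f)"
    by (rule smooth_near_cong)
      (use smooth_near_eventually[OF f] in \<open>auto simp: lie_bracket_def elim: eventually_mono\<close>)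
qed

lemma extend_vfield:
  assumes U: "open U" "p \<in> U" and V: "V \<in> vfields A U"
  obtains V' where "V' \<in> vfields A UNIV" "\<forall>\<^sub>F q in nhds p. V' q = V q"
proof -
  obtain h K where h: "smooth_fun A UNIV h" "closed K" "K \<subseteq> U" "\<And>q. q \<notin> K \<Longrightarrow> h q = 0"
    "\<forall>\<^sub>F q in nhds p. h q = 1"
    using bump_function[OF U] by blast
  define V' where "V' q = (if q \<in> U then tscale (h q) (V q) else 0)" for q
  have hV: "fscale h V \<in> vfields A U"
    by (rule vfields_fscale[OF U(1) V]) (use h(1) smooth_fun_UNIV in blast)
  have "vfield_near V' q" for q
  proof (cases "q \<in> U")
    case True
    then have "vfield_near (fscale h V) q" using hV vfields_iff[OF U(1)] by blast
    then show ?thesis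
      by (rule vfield_near_cong) (use True U(1) in \<open>auto simp: eventually_nhds V'_def fscale_def\<close>)
  next
    case False
    have "\<forall>\<^sub>F r in nhds q. (0 :: 'a tvec) = V' r"
    proof -
      have "\<forall>\<^sub>F r in nhds q. r \<in> - K"
        using eventually_nhds_in_open[of "- K" q] False h(2,3) by blast
      then show ?thesis
        by eventually_elim (simp add: V'_def h(4) tscale_def fun_eq_iff)
    qed
    then show ?thesis by (rule vfield_near_cong[OF vfield_near_zero])
  qed
  then have "V' \<in> vfields A UNIV" using vfields_iff by blast
  moreover have "\<forall>\<^sub>F q in nhds p. V' q = V q"
    using h(5) eventually_nhds_in_open[OF U] by eventually_elim (simp add: V'_def tscale_def)
  ultimately show ?thesis by (rule that)
qed

end

section \<open>Frames\<close>

context smooth_3manifold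
begin

section \<open>Coordinate functions and coordinate derivations\<close>

definition coord :: "('a \<Rightarrow> real ^ 3) \<Rightarrow> real ^ 3 \<Rightarrow> 'a \<Rightarrow> real" where
  "coord \<phi> l q = \<phi> q \<bullet> l"

text \<open>The directional derivative along the constant coordinate vector \<open>u\<close>; the
  default value 0 is the one that \<open>tangent_space\<close> prescribes on functions that are not
  smooth near \<open>q\<close>.\<close>

definition coord_deriv :: "'a chart \<Rightarrow> real ^ 3 \<Rightarrow> 'a vfield" where
  "coord_deriv c u q f = (if smooth_near A q f
     then frechet_derivative (f \<circ> inv_into (fst c) (snd c)) (at (snd c q)) u else 0)"

lemma smooth_near_coord:
  assumes "(D, \<phi>) \<in> A" "q \<in> D"
  shows "smooth_near A q (coord \<phi> l)"
  unfolding coord_def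
  by (rule smooth_near_chart[OF assms, where T = UNIV])
    (auto intro!: smooth_on_bounded_linear[OF bounded_linear_inner_left] smooth_on_ident)

lemma smooth_near_has_derivative:
  assumes c: "(D, \<phi>) \<in> A" "q \<in> D" and f: "smooth_near A q f"
  shows "((f \<circ> inv_into D \<phi>) has_derivative frechet_derivative (f \<circ> inv_into D \<phi>) (at (\<phi> q))) (at (\<phi> q))"
proof -
  obtain U where U: "open U" "q \<in> U" "smooth_fun A U f" using f smooth_nearE by blast
  have "smooth_on (\<phi> ` (D \<inter> U)) (f \<circ> inv_into D \<phi>)"
    using U(3) c(1) unfolding smooth_fun_def by blast
  then show ?thesis by (rule smooth_on_has_derivative) (use c U in blast)
qed

lemma coord_deriv_coord:
  assumes c: "(D, \<phi>) \<in> A" "q \<in> D"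
  shows "coord_deriv (D, \<phi>) u q (coord \<phi> l) = u \<bullet> l"
proof -
  have "((\<lambda>x. x \<bullet> l) has_derivative (\<lambda>u. u \<bullet> l)) (at (\<phi> q))"
    by (intro bounded_linear_imp_has_derivative bounded_linear_inner_left)
  moreover have "open (\<phi> ` D)" using chart_homeo[OF c(1)] by simp
  ultimately have "((coord \<phi> l \<circ> inv_into D \<phi>) has_derivative (\<lambda>u. u \<bullet> l)) (at (\<phi> q))"
    by (rule has_derivative_transform_within_open)
      (use c chart_inverse[OF c(1)] in \<open>auto simp: coord_def\<close>)
  then have "frechet_derivative (coord \<phi> l \<circ> inv_into D \<phi>) (at (\<phi> q)) = (\<lambda>u. u \<bullet> l)"
    using frechet_derivative_at by metis
  then show ?thesis
    using smooth_near_coord[OF c] by (simp add: coord_deriv_def)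
qed

lemma coord_deriv_tangent:
  assumes c: "(D, \<phi>) \<in> A" "q \<in> D"
  shows "coord_deriv (D, \<phi>) u q \<in> tangent_space A q"
  unfolding tangent_space_def mem_Collect_eq
proof (intro conjI allI impI; (elim conjE)?)
  let ?i = "inv_into D \<phi>" let ?d = "\<lambda>f. frechet_derivative (f \<circ> ?i) (at (\<phi> q))"
  fix f g assume f: "smooth_near A q f" and g: "smooth_near A q g"
  note df = smooth_near_has_derivative[OF c f] and dg = smooth_near_has_derivative[OF c g]
  have iq: "?i (\<phi> q) = q" by (rule chart_inverse[OF c])
  show "coord_deriv (D, \<phi>) u q f = coord_deriv (D, \<phi>) u q g" if eq: "\<forall>\<^sub>F r in nhds q. f r = g r"
  proof -
    obtain W where W: "open W" "q \<in> W" "\<And>r. r \<in> W \<Longrightarrow> f r = g r"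
      using eq unfolding eventually_nhds by blast
    have "?d f = ?d g"
    proof (rule frechet_derivative_transform_within_open)
      show "(f \<circ> ?i) differentiable at (\<phi> q)" using df by (auto simp: differentiable_def)
      show "open (\<phi> ` (D \<inter> W))" by (rule chart_image_open[OF c(1) W(1)])
      show "\<phi> q \<in> \<phi> ` (D \<inter> W)" using c W by blast
      show "(f \<circ> ?i) x = (g \<circ> ?i) x" if "x \<in> \<phi> ` (D \<inter> W)" for x
        using that W(3) chart_inverse[OF c(1)] by auto
    qed
    then show ?thesis using f g by (simp add: coord_deriv_def)
  qed
  show "coord_deriv (D, \<phi>) u q (\<lambda>r. a * f r + b * g r) =
      a * coord_deriv (D, \<phi>) u q f + b * coord_deriv (D, \<phi>) u q g" for a b
  proof -
    have s: "smooth_near A q (\<lambda>r. a * f r + b * g r)"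
      using f g by (intro smooth_near_add smooth_near_mult smooth_near_const)
    have "((\<lambda>x. a * (f \<circ> ?i) x + b * (g \<circ> ?i) x) has_derivative (\<lambda>u. a * ?d f u + b * ?d g u)) (at (\<phi> q))"
      by (intro has_derivative_add has_derivative_mult_right df dg)
    then have "?d (\<lambda>r. a * f r + b * g r) = (\<lambda>u. a * ?d f u + b * ?d g u)"
      by (subst frechet_derivative_at) (simp_all add: o_def)
    then show ?thesis using f g s by (simp add: coord_deriv_def)
  qed
  show "coord_deriv (D, \<phi>) u q (\<lambda>r. f r * g r) =
      f q * coord_deriv (D, \<phi>) u q g + coord_deriv (D, \<phi>) u q f * g q"
  proof -
    have "((\<lambda>x. (f \<circ> ?i) x * (g \<circ> ?i) x) has_derivative
        (\<lambda>u. (f \<circ> ?i) (\<phi> q) * ?d g u + ?d f u * (g \<circ> ?i) (\<phi> q))) (at (\<phi> q))"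
      by (intro has_derivative_mult df dg)
    then have "?d (\<lambda>r. f r * g r) = (\<lambda>u. f q * ?d g u + ?d f u * g q)"
      by (subst frechet_derivative_at) (simp_all add: o_def iq)
    then show ?thesis using f g smooth_near_mult[OF f g] by (simp add: coord_deriv_def)
  qed
qed (simp add: coord_deriv_def)

text \<open>A frame over \<open>U\<close> consists of global fields, since connections act on global fields only.\<close>

definition frame_on :: "'a set \<Rightarrow> (3 \<Rightarrow> 'a vfield) \<Rightarrow> bool" where
  "frame_on U Z \<longleftrightarrow> open U \<and> (\<forall>i. Z i \<in> vfields A UNIV) \<and>
     (\<forall>q\<in>U. \<forall>v\<in>tangent_space A q. \<exists>c. \<forall>f. v f = (\<Sum>i\<in>UNIV. c i * Z i q f))"

definition frame_matrix :: "(3 \<Rightarrow> 'a vfield) \<Rightarrow> ('a \<Rightarrow> real ^ 3) \<Rightarrow> 'a \<Rightarrow> real ^ 3 ^ 3" where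
  "frame_matrix Z \<phi> q = (\<chi> i j. Z i q (coord \<phi> (axis j 1)))"

lemma frame_matrix_mult:
  assumes Z: "frame_on U Z" and c: "(D, \<phi>) \<in> A" "q \<in> D"
  shows "(frame_matrix Z \<phi> q *v l) $ i = Z i q (coord \<phi> l)"
proof -
  have t: "Z i q \<in> tangent_space A q"
    using Z vfields_tangent unfolding frame_on_def by blast
  let ?x = "\<lambda>j. coord \<phi> (axis j 1)"
  note s = smooth_near_coord[OF c]
  have "?x j r = \<phi> r $ j" for j r by (simp add: coord_def inner_axis)
  \<comment> \<open>The factor 1 brings the sum of three terms into the shape
    \<open>a * f + b * g\<close> of \<open>tangent_linear\<close>, which is then applied
    twice.\<close>
  then have eq: "coord \<phi> l = (\<lambda>r. 1 * (l $ 1 * ?x 1 r + l $ 2 * ?x 2 r) + l $ 3 * ?x 3 r)"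
    by (intro ext) (simp add: coord_def[of \<phi> l] inner_vec_def sum_3 mult.commute)
  have eq1: "Z i q (\<lambda>r. 1 * (l $ 1 * ?x 1 r + l $ 2 * ?x 2 r) + l $ 3 * ?x 3 r) =
      1 * Z i q (\<lambda>r. l $ 1 * ?x 1 r + l $ 2 * ?x 2 r) + l $ 3 * Z i q (?x 3)"
    by (intro tangent_linear[OF t] smooth_near_add smooth_near_mult smooth_near_const s)
  have eq2: "Z i q (\<lambda>r. l $ 1 * ?x 1 r + l $ 2 * ?x 2 r) = l $ 1 * Z i q (?x 1) + l $ 2 * Z i q (?x 2)"
    by (intro tangent_linear[OF t] s)
  have "Z i q (coord \<phi> l) = l $ 1 * Z i q (?x 1) + l $ 2 * Z i q (?x 2) + l $ 3 * Z i q (?x 3)"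
    unfolding eq eq1 eq2 by simp
  then show ?thesis
    by (simp add: frame_matrix_def matrix_vector_mult_def sum_3 mult.commute)
qed

text \<open>If \<open>l\<close> is in the kernel, then every tangent vector kills the coordinate function of \<open>l\<close>, in
  particular the coordinate derivation in direction \<open>l\<close> does.\<close>

lemma frame_matrix_det:
  assumes Z: "frame_on U Z" and c: "(D, \<phi>) \<in> A" "q \<in> D" and q: "q \<in> U"
  shows "det (frame_matrix Z \<phi> q) \<noteq> 0"
proof -
  have "l = 0" if "frame_matrix Z \<phi> q *v l = 0" for l
  proof -
    have 0: "Z i q (coord \<phi> l) = 0" for i
      using frame_matrix_mult[OF Z c, of l i] that by simp
    have "\<exists>k. \<forall>f. coord_deriv (D, \<phi>) l q f = (\<Sum>i\<in>UNIV. k i * Z i q f)"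
      using Z q coord_deriv_tangent[OF c] unfolding frame_on_def by blast
    then have "coord_deriv (D, \<phi>) l q (coord \<phi> l) = 0" using 0 by auto
    then show ?thesis using coord_deriv_coord[OF c, of l l] by simp
  qed
  then have "invertible (frame_matrix Z \<phi> q)"
    using matrix_left_invertible_ker[of "frame_matrix Z \<phi> q"] invertible_left_inverse by blast
  then show ?thesis using invertible_det_nz by blast
qed

text \<open>Invertibility of the frame matrix lets a linear coordinate function take any prescribed
  derivatives along the frame at \<open>q\<close>; a cutoff makes it global without changing its
  germ. These functions extract coefficients with respect to the frame.\<close>

lemma frame_dual_function:
  assumes Z: "frame_on U Z" and q: "q \<in> U"
  obtains y where "smooth_fun A UNIV y" "\<forall>i. Z i q y = t i"
proof -
  obtain D \<phi> where c: "(D, \<phi>) \<in> A" "q \<in> D" using chart_exists .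
  have "det (frame_matrix Z \<phi> q) \<noteq> 0" by (rule frame_matrix_det[OF Z c q])
  then have "invertible (frame_matrix Z \<phi> q)" using invertible_det_nz by blast
  then obtain B where B: "frame_matrix Z \<phi> q ** B = mat 1" unfolding invertible_def by blast
  define l where "l = B *v (\<chi> i. t i)"
  have l: "frame_matrix Z \<phi> q *v l = (\<chi> i. t i)"
    by (simp add: l_def matrix_vector_mul_assoc B)
  obtain y where y: "smooth_fun A UNIV y" "\<forall>\<^sub>F r in nhds q. y r = coord \<phi> l r"
    using extend_fun[OF smooth_near_coord[OF c, of l]] .
  have "Z i q y = t i" for i
  proof -
    have "Z i q \<in> tangent_space A q" using Z vfields_tangent unfolding frame_on_def by blast
    then have "Z i q y = Z i q (coord \<phi> l)"
      by (rule tangent_cong) (use y smooth_fun_UNIV in auto)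
    also have "\<dots> = t i" using frame_matrix_mult[OF Z c, of l i] l by simp
    finally show ?thesis .
  qed
  then show ?thesis using that y(1) by blast
qed

lemma frame_independent:
  assumes Z: "frame_on U Z" and q: "q \<in> U"
    and eq: "\<And>f. smooth_fun A UNIV f \<Longrightarrow> (\<Sum>i\<in>UNIV. a i * Z i q f) = (\<Sum>i\<in>UNIV. b i * Z i q f)"
  shows "a i = b i"
proof -
  obtain y where y: "smooth_fun A UNIV y" "\<forall>j. Z j q y = (if j = i then 1 else 0)"
    by (rule frame_dual_function[OF Z q, of "\<lambda>j. if j = i then 1 else 0"])
  show ?thesis using eq[OF y(1)] y(2) by (simp add: if_distrib[of "(*) _"] cong: if_cong)
qed

lemma smooth_near_det_3:
  assumes "\<And>i j. smooth_near A p (\<lambda>q. m q i j)"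
  shows "smooth_near A p (\<lambda>q. det (\<chi> i j. m q i j :: real ^ 3 ^ 3))"
  unfolding det_3 vec_lambda_beta
  by (intro smooth_near_add smooth_near_diff smooth_near_mult assms)

text \<open>By Cramer's rule the coefficients are quotients of determinants of smooth functions,
  with denominator nonzero on the frame domain. They are then extended globally, since connections
  admit only global factors; hence the expansion holds just near \<open>p\<close>.\<close>

lemma frame_smooth_coefficients:
  assumes Z: "frame_on U Z" and p: "p \<in> U" and W: "W \<in> vfields A UNIV"
  obtains C where "\<And>i. smooth_fun A UNIV (C i)"
    "\<forall>\<^sub>F q in nhds p. \<forall>f. W q f = (\<Sum>i\<in>UNIV. C i q * Z i q f)"
proof -
  obtain D \<phi> where c: "(D, \<phi>) \<in> A" "p \<in> D" using chart_exists .
  let ?x = "\<lambda>j. coord \<phi> (axis j 1)"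
  \<comment> \<open>Transposed with respect to \<open>frame_matrix\<close>: the unknowns are now the
    coefficients of the fields, with one equation per coordinate. Below, \<open>n k\<close> replaces
    column \<open>k\<close> by the right-hand side.\<close>
  define m where "m q i j = Z j q (?x i)" for q and i j :: 3
  define n where "n k q i j = (if j = k then W q (?x i) else m q i j)" for k q and i j :: 3
  define C where "C k q = det (\<chi> i j. n k q i j) / det (\<chi> i j. m q i j)" for k q
  have m: "(\<chi> i j. m q i j) = transpose (frame_matrix Z \<phi> q)" for q
    by (simp add: m_def frame_matrix_def transpose_def)
  have s: "smooth_near A p (\<lambda>q. V q (?x j))" if "V \<in> vfields A UNIV" for V j
    using vfields_smooth[OF that open_UNIV UNIV_I smooth_near_coord[OF c]] .
  have Zv: "Z i \<in> vfields A UNIV" for i using Z unfolding frame_on_def by blast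
  have sC: "smooth_near A p (C k)" for k
    unfolding C_def
  proof (rule smooth_near_divide)
    have "smooth_near A p (\<lambda>q. n k q i j)" for i j
      by (cases "j = k") (simp_all add: n_def m_def s W Zv)
    then show "smooth_near A p (\<lambda>q. det (\<chi> i j. n k q i j))"
      by (rule smooth_near_det_3)
    show "smooth_near A p (\<lambda>q. det (\<chi> i j. m q i j))"
      by (rule smooth_near_det_3) (use s Zv in \<open>auto simp: m_def\<close>)
    show "det (\<chi> i j. m p i j) \<noteq> 0"
      unfolding m det_transpose by (rule frame_matrix_det[OF Z c p])
  qed
  have CW: "W q f = (\<Sum>i\<in>UNIV. C i q * Z i q f)" if q: "q \<in> U" "q \<in> D" for q f
  proof -
    obtain a where a: "\<And>f. W q f = (\<Sum>i\<in>UNIV. a i * Z i q f)"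
      using Z q(1) vfields_tangent[OF W, of q] unfolding frame_on_def by blast
    have "det (\<chi> i j. m q i j) \<noteq> 0"
      unfolding m det_transpose by (rule frame_matrix_det[OF Z c(1) q(2) q(1)])
    moreover have "(\<chi> i j. m q i j) *v (\<chi> i. a i) = (\<chi> j. W q (?x j))"
      by (simp add: vec_eq_iff matrix_vector_mult_def a m_def mult.commute)
    ultimately have "(\<chi> i. a i) = (\<chi> k. det (\<chi> i j. if j = k then (\<chi> j. W q (?x j)) $ i
        else (\<chi> i j. m q i j) $ i $ j) / det (\<chi> i j. m q i j))"
      using cramer[of "\<chi> i j. m q i j"] by blast
    then have "a k = C k q" for k
      by (simp add: vec_eq_iff C_def n_def cong: if_cong)
    then show ?thesis using a by simp
  qed
  obtain C' where C': "\<And>i. smooth_fun A UNIV (C' i)" "\<And>i. \<forall>\<^sub>F q in nhds p. C' i q = C i q"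
  proof -
    have "\<forall>i. \<exists>F. smooth_fun A UNIV F \<and> (\<forall>\<^sub>F q in nhds p. F q = C i q)"
      using extend_fun[OF sC] by metis
    then show ?thesis using that by metis
  qed
  have "open U" using Z unfolding frame_on_def by blast
  then have "\<forall>\<^sub>F q in nhds p. q \<in> U \<and> q \<in> D"
    using p c(2) chart_open[OF c(1)] by (intro eventually_conj eventually_nhds_in_open)
  moreover have "\<forall>\<^sub>F q in nhds p. \<forall>i. C' i q = C i q"
    using C'(2) by (simp add: eventually_all_finite)
  ultimately have "\<forall>\<^sub>F q in nhds p. \<forall>f. W q f = (\<Sum>i\<in>UNIV. C' i q * Z i q f)"
    by eventually_elim (use CW in simp)
  then show ?thesis by (rule that[OF C'(1)])
qed

text \<open>Leibniz rule in both entries. Modulo \<open>X1 p\<close> and \<open>X2 p\<close> only a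
  determinant multiple of \<open>lie_bracket A X1 X2 p\<close> survives, so a single bracket
  accounts for all brackets of horizontal fields.\<close>

lemma lie_bracket_combination:
  assumes U: "open U" "p \<in> U" and X: "X1 \<in> vfields A U" "X2 \<in> vfields A U"
    and VW: "V \<in> vfields A U" "W \<in> vfields A U"
    and s: "smooth_near A p a1" "smooth_near A p a2" "smooth_near A p b1" "smooth_near A p b2"
    and V: "\<And>q. q \<in> U \<Longrightarrow> V q = tscale (a1 q) (X1 q) + tscale (a2 q) (X2 q)"
    and W: "\<And>q. q \<in> U \<Longrightarrow> W q = tscale (b1 q) (X1 q) + tscale (b2 q) (X2 q)"
  shows "lie_bracket A V W p = tscale (V p b1 - W p a1) (X1 p) + tscale (V p b2 - W p a2) (X2 p)
    + tscale (a1 p * b2 p - a2 p * b1 p) (lie_bracket A X1 X2 p)"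
proof (rule ext)
  fix f
  show "lie_bracket A V W p f = (tscale (V p b1 - W p a1) (X1 p) + tscale (V p b2 - W p a2) (X2 p)
    + tscale (a1 p * b2 p - a2 p * b1 p) (lie_bracket A X1 X2 p)) f"
  proof (cases "smooth_near A p f")
    case False
    then show ?thesis
      using tangent_nonsmooth[OF vfields_tangent[OF X(1) U(2)] False]
        tangent_nonsmooth[OF vfields_tangent[OF X(2) U(2)] False]
      by (simp add: lie_bracket_def tscale_def)
  next
    case f: True
    have X1f: "smooth_near A p (\<lambda>q. X1 q f)" and X2f: "smooth_near A p (\<lambda>q. X2 q f)"
      using vfields_smooth[OF _ U f] X by auto
    have *: "Y p (\<lambda>q. Y' q f) =
        c1 p * Y p (\<lambda>q. X1 q f) + Y p c1 * X1 p f + (c2 p * Y p (\<lambda>q. X2 q f) + Y p c2 * X2 p f)"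
      if Y: "Y \<in> vfields A U" and Y': "Y' \<in> vfields A U"
        and c: "smooth_near A p c1" "smooth_near A p c2"
        and eq: "\<And>q. q \<in> U \<Longrightarrow> Y' q = tscale (c1 q) (X1 q) + tscale (c2 q) (X2 q)" for Y Y' c1 c2
    proof -
      note Yp = vfields_tangent[OF Y U(2)]
      have "\<forall>\<^sub>F q in nhds p. Y' q f = c1 q * X1 q f + c2 q * X2 q f"
        using eventually_nhds_in_open[OF U] by eventually_elim (simp add: eq tscale_def)
      then have "Y p (\<lambda>q. Y' q f) = Y p (\<lambda>q. c1 q * X1 q f + c2 q * X2 q f)"
        by (rule tangent_cong[OF Yp vfields_smooth[OF Y' U f]])
      also have "\<dots> = Y p (\<lambda>q. c1 q * X1 q f) + Y p (\<lambda>q. c2 q * X2 q f)"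
        by (intro tangent_add[OF Yp] smooth_near_mult c X1f X2f)
      finally show ?thesis
        using tangent_mult[OF Yp c(1) X1f] tangent_mult[OF Yp c(2) X2f] by simp
    qed
    have "V p (\<lambda>q. W q f) =
        b1 p * V p (\<lambda>q. X1 q f) + V p b1 * X1 p f + (b2 p * V p (\<lambda>q. X2 q f) + V p b2 * X2 p f)"
      by (rule *[OF VW s(3,4) W])
    moreover have "W p (\<lambda>q. V q f) =
        a1 p * W p (\<lambda>q. X1 q f) + W p a1 * X1 p f + (a2 p * W p (\<lambda>q. X2 q f) + W p a2 * X2 p f)"
      by (rule *[OF VW(2,1) s(1,2) V])
    moreover have "V p h = a1 p * X1 p h + a2 p * X2 p h" "W p h = b1 p * X1 p h + b2 p * X2 p h" for h
      using V[OF U(2)] W[OF U(2)] by (simp_all add: tscale_def)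
    ultimately have "V p (\<lambda>q. W q f) - W p (\<lambda>q. V q f) =
        (V p b1 - W p a1) * X1 p f + (V p b2 - W p a2) * X2 p f
        + (a1 p * b2 p - a2 p * b1 p) * (X1 p (\<lambda>q. X2 q f) - X2 p (\<lambda>q. X1 q f))"
      by (simp add: algebra_simps)
    then show ?thesis using f by (simp add: lie_bracket_def tscale_def)
  qed
qed

end

section \<open>Bases of the fibers in terms of coefficients\<close>

lemma span_pair: "v \<in> tv.span {x, y} \<longleftrightarrow> (\<exists>a b. v = tscale a x + tscale b y)"
proof -
  have "v \<in> tv.span {x, y} \<longleftrightarrow> (\<exists>a b. v - tscale a x = tscale b y)"
    by (auto simp: tv.span_insert tv.span_singleton)
  also have "\<dots> \<longleftrightarrow> (\<exists>a b. v = tscale a x + tscale b y)"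
    by (simp add: algebra_simps)
  finally show ?thesis .
qed

lemma fiber_basis_iff:
  "fiber_basis H p x y \<longleftrightarrow> H p = {v. \<exists>a b. v = tscale a x + tscale b y} \<and>
     (\<forall>a b. tscale a x + tscale b y = 0 \<longrightarrow> a = 0 \<and> b = 0)" (is "_ \<longleftrightarrow> ?S \<and> ?I")
proof -
  have "x \<noteq> y \<and> tv.independent {x, y} \<longleftrightarrow> ?I"
  proof
    assume xy: "x \<noteq> y \<and> tv.independent {x, y}"
    show ?I
    proof (intro allI impI)
      fix a b assume 0: "tscale a x + tscale b y = 0"
      from xy have x: "x \<notin> tv.span {y}" and y: "y \<noteq> 0"
        by (auto simp: tv.independent_insert split: if_splits)
      have "a = 0"
      proof (rule ccontr)
        assume "a \<noteq> 0"
        then have "x = tscale (- b / a) y"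
          using 0 by (simp add: tscale_def fun_eq_iff field_simps eq_neg_iff_add_eq_0)
        then show False using x unfolding tv.span_singleton by blast
      qed
      then show "a = 0 \<and> b = 0" using 0 y by simp
    qed
  next
    assume I: ?I
    have "x \<noteq> y"
    proof
      assume "x = y"
      then have "tscale 1 x + tscale (- 1) y = 0" by (simp add: tscale_def fun_eq_iff)
      from I[rule_format, OF this] show False by simp
    qed
    moreover have "y \<noteq> 0"
    proof
      assume "y = 0"
      then have "tscale 0 x + tscale 1 y = 0" by (simp add: tscale_def fun_eq_iff)
      from I[rule_format, OF this] show False by simp
    qed
    moreover have "x \<notin> tv.span {y}"
    proof
      assume "x \<in> tv.span {y}"
      then obtain k where "x = tscale k y" by (auto simp: tv.span_singleton)
      then have "tscale 1 x + tscale (- k) y = 0" by (simp add: tscale_def fun_eq_iff)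
      from I[rule_format, OF this] show False by simp
    qed
    ultimately show "x \<noteq> y \<and> tv.independent {x, y}"
      by (simp add: tv.independent_insert)
  qed
  moreover have "tv.span {x, y} = H p \<longleftrightarrow> ?S"
    using span_pair[of _ x y] by auto
  ultimately show ?thesis unfolding fiber_basis_def by blast
qed

section \<open>Adapted frames on a sub-Riemannian manifold\<close>

locale oriented_sub_riemannian = smooth_3manifold A
  for A :: "('a::{t2_space, second_countable_topology}) chart set" +
  fixes H :: "'a distribution" and ip :: "'a fiber_metric"
    and pos :: "'a \<Rightarrow> 'a tvec \<Rightarrow> 'a tvec \<Rightarrow> bool"
  assumes sub_riemannian: "sub_riemannian_2_3 A H ip"
    and orientation: "hbundle_orientation A H pos"
begin

lemma inner: "smooth_fiber_inner A H ip"
  using sub_riemannian unfolding sub_riemannian_2_3_def by simp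

lemma generating: "bracket_generating A H"
  using sub_riemannian unfolding sub_riemannian_2_3_def by simp

lemma inner_at:
  assumes "x \<in> H p" "y \<in> H p"
  shows "ip p x y = ip p y x \<and>
    (\<forall>z\<in>H p. \<forall>a b. ip p (tscale a x + tscale b y) z = a * ip p x z + b * ip p y z) \<and>
    (x \<noteq> 0 \<longrightarrow> ip p x x > 0)"
  using inner[unfolded smooth_fiber_inner_def, THEN conjunct1, THEN spec, THEN bspec, OF assms(1), THEN bspec, OF assms(2)] .

lemma inner_smooth:
  assumes "open U" "V \<in> hsections A H U" "W \<in> hsections A H U"
  shows "smooth_fun A U (\<lambda>q. ip q (V q) (W q))"
  using inner[unfolded smooth_fiber_inner_def, THEN conjunct2, THEN spec, THEN spec, THEN spec] assms
  by simp

text \<open>The axioms give linearity in the first slot; the second slot is reached through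
  symmetry.\<close>

lemma inner_combination:
  assumes b: "fiber_basis H p x y"
  shows "ip p (tscale a x + tscale b y) (tscale c x + tscale d y) =
    a * c * ip p x x + (a * d + b * c) * ip p x y + b * d * ip p y y"
proof -
  have H: "tscale a x + tscale b y \<in> H p" for a b
    using b unfolding fiber_basis_iff by blast
  have x: "x \<in> H p" and y: "y \<in> H p"
    using H[of 1 0] H[of 0 1] by simp_all
  have lin: "ip p (tscale a x + tscale b y) z = a * ip p x z + b * ip p y z" if "z \<in> H p" for a b z
    using inner_at[OF x y] that by blast
  let ?w = "tscale c x + tscale d y"
  have "ip p x ?w = c * ip p x x + d * ip p y x"
    using inner_at[OF x H, of c d] lin[OF x] by simp
  moreover have "ip p y ?w = c * ip p x y + d * ip p y y"
    using inner_at[OF y H, of c d] lin[OF y] by simp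
  moreover have "ip p y x = ip p x y"
    using inner_at[OF x y] by simp
  ultimately show ?thesis
    unfolding lin[OF H] by (simp add: algebra_simps)
qed

lemma fiber_basis_transform:
  assumes b: "fiber_basis H p x y" and d: "a * d - b * c \<noteq> 0"
  shows "fiber_basis H p (tscale a x + tscale b y) (tscale c x + tscale d y)"
proof -
  let ?D = "a * d - b * c"
  have comb: "tscale s (tscale a x + tscale b y) + tscale t (tscale c x + tscale d y) =
      tscale (s * a + t * c) x + tscale (s * b + t * d) y" for s t
    by (simp add: tscale_def fun_eq_iff algebra_simps)
  \<comment> \<open>The coefficients come from the inverse of the 2x2 matrix with rows
    \<open>(a, b)\<close> and \<open>(c, d)\<close>.\<close>
  have inv: "tscale s x + tscale t y =
      tscale ((s * d - t * c) / ?D) (tscale a x + tscale b y) + tscale ((t * a - s * b) / ?D) (tscale c x + tscale d y)"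
    for s t
  proof -
    have "(s * d - t * c) / ?D * a + (t * a - s * b) / ?D * c = s * ?D / ?D"
      unfolding times_divide_eq_left add_divide_distrib[symmetric] by (simp add: algebra_simps)
    then have 1: "(s * d - t * c) / ?D * a + (t * a - s * b) / ?D * c = s" using d by simp
    have "(s * d - t * c) / ?D * b + (t * a - s * b) / ?D * d = t * ?D / ?D"
      unfolding times_divide_eq_left add_divide_distrib[symmetric] by (simp add: algebra_simps)
    then have 2: "(s * d - t * c) / ?D * b + (t * a - s * b) / ?D * d = t" using d by simp
    show ?thesis unfolding comb 1 2 ..
  qed
  have "s = 0 \<and> t = 0" if "s * a + t * c = 0" "s * b + t * d = 0" for s t
  proof -
    have "s * ?D = (s * a + t * c) * d - (s * b + t * d) * c"
      "t * ?D = (s * b + t * d) * a - (s * a + t * c) * b"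
      by (simp_all add: algebra_simps)
    then have "s * ?D = 0" "t * ?D = 0" unfolding that by simp_all
    then show ?thesis using d by simp
  qed
  then have "s = 0 \<and> t = 0"
    if "tscale s (tscale a x + tscale b y) + tscale t (tscale c x + tscale d y) = 0" for s t
    using that b unfolding fiber_basis_iff comb by blast
  moreover have "H p = {v. \<exists>s t. v = tscale s (tscale a x + tscale b y) + tscale t (tscale c x + tscale d y)}"
  proof -
    have "H p = {v. \<exists>s t. v = tscale s x + tscale t y}"
      using b unfolding fiber_basis_iff by blast
    also have "\<dots> = {v. \<exists>s t. v = tscale s (tscale a x + tscale b y) + tscale t (tscale c x + tscale d y)}"
      using comb inv by blast
    finally show ?thesis .
  qed
  ultimately show ?thesis unfolding fiber_basis_iff by blast
qed

text \<open>Gram-Schmidt: with \<open>e, f, g\<close> the entries of the Gram matrix of \<open>Y1, Y2\<close>, the field \<open>e Y2 - f Y1\<close> is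
  orthogonal to \<open>Y1\<close> and has squared norm \<open>s = e (e g - f\<^sup>2)\<close>.\<close>

lemma oriented_orthonormal_frame_exists:
  obtains U X1 X2 where "p \<in> U" "oriented_orthonormal_frame A H ip pos U X1 X2"
proof -
  have "\<exists>U X1 X2. p \<in> U \<and> hframe A H U X1 X2 \<and> (\<forall>q\<in>U. pos q (X1 q) (X2 q))"
    using orientation[unfolded hbundle_orientation_def, THEN conjunct2, THEN spec] .
  then obtain U Y1 Y2 where pU: "p \<in> U" and fr: "hframe A H U Y1 Y2"
    and ps: "\<And>q. q \<in> U \<Longrightarrow> pos q (Y1 q) (Y2 q)" by blast
  have U: "open U" and Y: "Y1 \<in> vfields A U" "Y2 \<in> vfields A U"
    and fb: "\<And>q. q \<in> U \<Longrightarrow> fiber_basis H q (Y1 q) (Y2 q)"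
    using fr unfolding hframe_def by auto
  have YH: "Y1 q \<in> H q" "Y2 q \<in> H q" if "q \<in> U" for q
  proof -
    have "tscale a (Y1 q) + tscale b (Y2 q) \<in> H q" for a b
      using fb[OF that] unfolding fiber_basis_iff by blast
    from this[of 1 0] this[of 0 1] show "Y1 q \<in> H q" "Y2 q \<in> H q" by simp_all
  qed
  define e where "e q = ip q (Y1 q) (Y1 q)" for q
  define f where "f q = ip q (Y1 q) (Y2 q)" for q
  define g where "g q = ip q (Y2 q) (Y2 q)" for q
  define s where "s q = e q * (e q * g q - f q * f q)" for q
  have comb: "ip q (tscale a (Y1 q) + tscale b (Y2 q)) (tscale c (Y1 q) + tscale d (Y2 q)) =
      a * c * e q + (a * d + b * c) * f q + b * d * g q" if "q \<in> U" for q a b c d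
    using inner_combination[OF fb[OF that]] by (simp add: e_def f_def g_def)
  have pos_ip: "a * a * e q + (a * b + b * a) * f q + b * b * g q > 0"
    if q: "q \<in> U" and ab: "a \<noteq> 0 \<or> b \<noteq> 0" for q a b
  proof -
    let ?z = "tscale a (Y1 q) + tscale b (Y2 q)"
    have "?z \<noteq> 0" "?z \<in> H q" using fb[OF q] ab unfolding fiber_basis_iff by blast+
    then have "ip q ?z ?z > 0" using inner_at by blast
    then show ?thesis using comb[OF q] by simp
  qed
  have e0: "e q > 0" if "q \<in> U" for q using pos_ip[OF that, of 1 0] by simp
  have s0: "s q > 0" if "q \<in> U" for q
    using pos_ip[OF that, of "- f q" "e q"] e0[OF that] by (simp add: s_def algebra_simps)
  have "Y1 \<in> hsections A H U" "Y2 \<in> hsections A H U"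
    using Y YH by (auto simp: hsections_def)
  then have "smooth_fun A U e" "smooth_fun A U f" "smooth_fun A U g"
    unfolding e_def f_def g_def using inner_smooth[OF U] by auto
  then have sm: "smooth_near A q e" "smooth_near A q f" "smooth_near A q g" if "q \<in> U" for q
    using that smooth_fun_iff_near[OF U] by auto
  have sms: "smooth_near A q s" if "q \<in> U" for q
    unfolding s_def by (intro smooth_near_mult smooth_near_diff sm that)
  have sqrt0: "sqrt (e q) > 0" "sqrt (s q) > 0" if "q \<in> U" for q
    using e0[OF that] s0[OF that] by auto
  define a where "a q = 1 / sqrt (e q)" for q
  define c where "c q = - f q / sqrt (s q)" for q
  define d where "d q = e q / sqrt (s q)" for q
  define X1 where "X1 = fscale a Y1"
  define X2 where "X2 = fscale c Y1 + fscale d Y2"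
  have X: "X1 q = tscale (a q) (Y1 q) + tscale 0 (Y2 q)" "X2 q = tscale (c q) (Y1 q) + tscale (d q) (Y2 q)" for q
    by (simp_all add: X1_def X2_def fscale_def)
  have smooth: "smooth_near A q a" "smooth_near A q c" "smooth_near A q d" if q: "q \<in> U" for q
  proof -
    have "smooth_near A q (\<lambda>q. - f q)" using smooth_near_diff[OF smooth_near_const[of q 0] sm(2)[OF q]] by simp
    moreover have "smooth_near A q (\<lambda>q. sqrt (s q))" "smooth_near A q (\<lambda>q. sqrt (e q))"
      by (rule smooth_near_sqrt[OF sms[OF q] s0[OF q]], rule smooth_near_sqrt[OF sm(1)[OF q] e0[OF q]])
    moreover have "sqrt (s q) \<noteq> 0" "sqrt (e q) \<noteq> 0" using sqrt0[OF q] by simp_all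
    ultimately have "smooth_near A q a \<and> smooth_near A q c \<and> smooth_near A q d"
      unfolding a_def c_def d_def using sm(1)[OF q]
      by (intro conjI smooth_near_divide smooth_near_const)
    then show "smooth_near A q a" "smooth_near A q c" "smooth_near A q d" by simp_all
  qed
  have Xv: "X1 \<in> vfields A U" "X2 \<in> vfields A U"
    unfolding X1_def X2_def using smooth Y by (auto intro!: vfields_add vfields_fscale U)
  \<comment> \<open>The determinant of the triangular Gram-Schmidt matrix. Being nonzero it keeps a
    basis, and being positive it keeps the orientation.\<close>
  have ad: "a q * d q - 0 * c q > 0" if "q \<in> U" for q
    unfolding a_def d_def using sqrt0[OF that] e0[OF that] by simp
  have "fiber_basis H q (X1 q) (X2 q)" if "q \<in> U" for q
    unfolding X by (rule fiber_basis_transform[OF fb[OF that] less_imp_neq[OF ad[OF that], symmetric]])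
  moreover have "pos q (X1 q) (X2 q)" if "q \<in> U" for q
  proof -
    have "pos q (X1 q) (X2 q) \<longleftrightarrow> (pos q (Y1 q) (Y2 q) \<longleftrightarrow> a q * d q - 0 * c q > 0)"
      unfolding X
      by (rule orientation[unfolded hbundle_orientation_def, THEN conjunct1, rule_format])
        (use fb[OF that] less_imp_neq[OF ad[OF that], symmetric] in blast)
    then show ?thesis using ps[OF that] ad[OF that] by blast
  qed
  moreover have "ip q (X1 q) (X1 q) = 1 \<and> ip q (X2 q) (X2 q) = 1 \<and> ip q (X1 q) (X2 q) = 0" if q: "q \<in> U" for q
  proof (intro conjI)
    have e2: "sqrt (e q) * sqrt (e q) = e q" and s2: "sqrt (s q) * sqrt (s q) = s q"
      using e0[OF q] s0[OF q] by auto
    have "a q * a q * e q = e q / (sqrt (e q) * sqrt (e q))" by (simp add: a_def)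
    then show "ip q (X1 q) (X1 q) = 1"
      unfolding X comb[OF q] e2 using e0[OF q] by simp
    \<comment> \<open>Stated for arbitrary reals to keep the square roots out of the algebra; for
      \<open>k = 0\<close> both sides are 0, as division by zero gives 0.\<close>
    have "(- y / k) * (- y / k) * x + ((- y / k) * (x / k) + (x / k) * (- y / k)) * y + (x / k) * (x / k) * z =
        x * (x * z - y * y) / (k * k)" for x y z k :: real
      by (cases "k = 0") (simp_all add: field_simps)
    then have "c q * c q * e q + (c q * d q + d q * c q) * f q + d q * d q * g q = s q / (sqrt (s q) * sqrt (s q))"
      unfolding c_def d_def s_def .
    then show "ip q (X2 q) (X2 q) = 1"
      unfolding X comb[OF q] s2 using s0[OF q] by simp
    show "ip q (X1 q) (X2 q) = 0"
      unfolding X comb[OF q] by (simp add: c_def d_def)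
  qed
  ultimately have "oriented_orthonormal_frame A H ip pos U X1 X2"
    unfolding oriented_orthonormal_frame_def orthonormal_frame_def hframe_def using U Xv by blast
  then show ?thesis using that pU by blast
qed

text \<open>The fields are global so that a connection applies to them, but orthonormality is asked
  on \<open>U\<close> only, since \<open>H\<close> need not have a global frame.\<close>

definition adapted_frame :: "'a set \<Rightarrow> 'a vfield \<Rightarrow> 'a vfield \<Rightarrow> bool" where
  "adapted_frame U X1 X2 \<longleftrightarrow> X1 \<in> vfields A UNIV \<and> X2 \<in> vfields A UNIV \<and>
     oriented_orthonormal_frame A H ip pos U X1 X2"

lemma adapted_frame_exists:
  obtains U X1 X2 where "p \<in> U" "adapted_frame U X1 X2"
proof -
  obtain U Y1 Y2 where pU: "p \<in> U" and fr: "oriented_orthonormal_frame A H ip pos U Y1 Y2"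
    by (rule oriented_orthonormal_frame_exists)
  have U: "open U" and Y: "Y1 \<in> vfields A U" "Y2 \<in> vfields A U"
    using fr unfolding oriented_orthonormal_frame_def orthonormal_frame_def hframe_def by auto
  obtain X1 where X1: "X1 \<in> vfields A UNIV" "\<forall>\<^sub>F q in nhds p. X1 q = Y1 q"
    by (rule extend_vfield[OF U pU Y(1)])
  obtain X2 where X2: "X2 \<in> vfields A UNIV" "\<forall>\<^sub>F q in nhds p. X2 q = Y2 q"
    by (rule extend_vfield[OF U pU Y(2)])
  have "\<forall>\<^sub>F q in nhds p. q \<in> U \<and> X1 q = Y1 q \<and> X2 q = Y2 q"
    using eventually_nhds_in_open[OF U pU] X1(2) X2(2) by eventually_elim simp
  then obtain W where W: "open W" "p \<in> W" "\<And>q. q \<in> W \<Longrightarrow> q \<in> U \<and> X1 q = Y1 q \<and> X2 q = Y2 q"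
    unfolding eventually_nhds by blast
  have "X1 \<in> vfields A W" "X2 \<in> vfields A W"
    using vfields_subset[OF X1(1)] vfields_subset[OF X2(1)] by auto
  then have "oriented_orthonormal_frame A H ip pos W X1 X2"
    using fr W unfolding oriented_orthonormal_frame_def orthonormal_frame_def hframe_def by simp
  then have "adapted_frame W X1 X2" using X1(1) X2(1) by (simp add: adapted_frame_def)
  then show ?thesis using that W(2) by blast
qed

definition bracket_frame :: "'a vfield \<Rightarrow> 'a vfield \<Rightarrow> 3 \<Rightarrow> 'a vfield" where
  "bracket_frame X1 X2 i = (if i = 1 then X1 else if i = 2 then X2 else lie_bracket A X1 X2)"

lemma bracket_frame_simps [simp]:
  "bracket_frame X1 X2 1 = X1" "bracket_frame X1 X2 2 = X2" "bracket_frame X1 X2 3 = lie_bracket A X1 X2"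
  by (simp_all add: bracket_frame_def)

lemma horizontal_coefficients:
  assumes b: "fiber_basis H q x y" and on: "ip q x x = 1" "ip q y y = 1" "ip q x y = 0"
    and v: "v \<in> H q"
  shows "v = tscale (ip q v x) x + tscale (ip q v y) y"
proof -
  obtain a c where ac: "v = tscale a x + tscale c y"
    using v b unfolding fiber_basis_iff by blast
  have "ip q v (tscale 1 x + tscale 0 y) = a" "ip q v (tscale 0 x + tscale 1 y) = c"
    unfolding ac inner_combination[OF b] by (simp_all add: on)
  then show ?thesis by (simp add: ac)
qed

lemma adapted_frame_horizontal:
  assumes F: "adapted_frame U X1 X2"
  shows "X1 \<in> hsections A H U" "X2 \<in> hsections A H U"
proof -
  have "X1 q \<in> H q \<and> X2 q \<in> H q" if "q \<in> U" for q
  proof -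
    have "tscale a (X1 q) + tscale b (X2 q) \<in> H q" for a b
      using F that unfolding adapted_frame_def oriented_orthonormal_frame_def orthonormal_frame_def
        hframe_def fiber_basis_iff by blast
    from this[of 1 0] this[of 0 1] show ?thesis by simp
  qed
  then show "X1 \<in> hsections A H U" "X2 \<in> hsections A H U"
    using F unfolding adapted_frame_def hsections_def by (auto intro: vfields_subset)
qed

text \<open>Coefficients in an orthonormal frame are fiber inner products, which are smooth along
  horizontal sections; this puts arbitrary sections within reach of the Leibniz expansion of the
  bracket.\<close>

lemma adapted_frame_bracket:
  assumes F: "adapted_frame U X1 X2" and p: "p \<in> U"
    and W: "open W" "p \<in> W" "V1 \<in> hsections A H W" "V2 \<in> hsections A H W"
  shows "\<exists>a b c. lie_bracket A V1 V2 p = tscale a (X1 p) + tscale b (X2 p) + tscale c (lie_bracket A X1 X2 p)"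
proof -
  have U: "open U" and fb: "\<And>q. q \<in> U \<Longrightarrow> fiber_basis H q (X1 q) (X2 q)"
    and on: "\<And>q. q \<in> U \<Longrightarrow> ip q (X1 q) (X1 q) = 1" "\<And>q. q \<in> U \<Longrightarrow> ip q (X2 q) (X2 q) = 1"
      "\<And>q. q \<in> U \<Longrightarrow> ip q (X1 q) (X2 q) = 0"
    using F unfolding adapted_frame_def oriented_orthonormal_frame_def orthonormal_frame_def hframe_def by auto
  let ?N = "U \<inter> W"
  have N: "open ?N" "p \<in> ?N" using U W p by auto
  have sub: "V \<in> hsections A H ?N" if "V \<in> hsections A H S" "?N \<subseteq> S" for V S
    using that vfields_subset[OF _ that(2)] unfolding hsections_def by blast
  have h: "X1 \<in> hsections A H ?N" "X2 \<in> hsections A H ?N" "V1 \<in> hsections A H ?N" "V2 \<in> hsections A H ?N"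
    using adapted_frame_horizontal[OF F] W by (auto intro: sub)
  have v: "V \<in> vfields A ?N" if "V \<in> hsections A H ?N" for V
    using that by (simp add: hsections_def)
  have s: "smooth_near A p (\<lambda>q. ip q (V q) (X q))" if "V \<in> hsections A H ?N" "X \<in> hsections A H ?N" for V X
    using inner_smooth[OF N(1) that] smooth_fun_iff_near[OF N(1)] N(2) by blast
  have dec: "V q = tscale (ip q (V q) (X1 q)) (X1 q) + tscale (ip q (V q) (X2 q)) (X2 q)"
    if "V \<in> hsections A H ?N" "q \<in> ?N" for V q
    by (rule horizontal_coefficients) (use that fb on in \<open>auto simp: hsections_def\<close>)
  show ?thesis
    using lie_bracket_combination[OF N v[OF h(1)] v[OF h(2)] v[OF h(3)] v[OF h(4)] s[OF h(3) h(1)]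
        s[OF h(3) h(2)] s[OF h(4) h(1)] s[OF h(4) h(2)] dec[OF h(3)] dec[OF h(4)]] by blast
qed

lemma adapted_frame_frame_on:
  assumes F: "adapted_frame U X1 X2"
  shows "frame_on U (bracket_frame X1 X2)"
  unfolding frame_on_def
proof (intro conjI allI ballI)
  show "open U"
    using F unfolding adapted_frame_def oriented_orthonormal_frame_def orthonormal_frame_def hframe_def by blast
  show "bracket_frame X1 X2 i \<in> vfields A UNIV" for i
    using F lie_bracket_vfields[OF open_UNIV, of X1 X2] unfolding adapted_frame_def bracket_frame_def by auto
  fix q v assume q: "q \<in> U" and v: "v \<in> tangent_space A q"
  let ?S = "{v. \<exists>a b c. v = tscale a (X1 q) + tscale b (X2 q) + tscale c (lie_bracket A X1 X2 q)}"
  have sub: "tv.subspace ?S"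
  proof (rule tv.subspaceI)
    have "0 = tscale 0 (X1 q) + tscale 0 (X2 q) + tscale 0 (lie_bracket A X1 X2 q)"
      by simp
    then show "0 \<in> ?S" by blast
  next
    fix x y assume "x \<in> ?S" "y \<in> ?S"
    then obtain a b c a' b' c' where
      "x = tscale a (X1 q) + tscale b (X2 q) + tscale c (lie_bracket A X1 X2 q)"
      "y = tscale a' (X1 q) + tscale b' (X2 q) + tscale c' (lie_bracket A X1 X2 q)" by blast
    then have "x + y = tscale (a + a') (X1 q) + tscale (b + b') (X2 q) + tscale (c + c') (lie_bracket A X1 X2 q)"
      by (simp add: tv.scale_left_distrib)
    then show "x + y \<in> ?S" by blast
  next
    fix k x assume "x \<in> ?S"
    then obtain a b c where
      "x = tscale a (X1 q) + tscale b (X2 q) + tscale c (lie_bracket A X1 X2 q)" by blast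
    then have "tscale k x = tscale (k * a) (X1 q) + tscale (k * b) (X2 q) + tscale (k * c) (lie_bracket A X1 X2 q)"
      by (simp add: tv.scale_right_distrib)
    then show "tscale k x \<in> ?S" by blast
  qed
  have "H q \<subseteq> ?S"
  proof
    fix x assume "x \<in> H q"
    moreover have "fiber_basis H q (X1 q) (X2 q)"
      using F q unfolding adapted_frame_def oriented_orthonormal_frame_def orthonormal_frame_def hframe_def
      by blast
    ultimately obtain a b where "x = tscale a (X1 q) + tscale b (X2 q)"
      unfolding fiber_basis_iff by blast
    then have "x = tscale a (X1 q) + tscale b (X2 q) + tscale 0 (lie_bracket A X1 X2 q)" by simp
    then show "x \<in> ?S" by blast
  qed
  moreover have "{lie_bracket A V W q | U V W.
      open U \<and> q \<in> U \<and> V \<in> hsections A H U \<and> W \<in> hsections A H U} \<subseteq> ?S"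
    using adapted_frame_bracket[OF F q] by blast
  ultimately have "tangent_space A q \<subseteq> ?S"
    \<comment> \<open>Read from right to left, the bracket-generating condition rewrites the tangent
      space as a span, which lies in \<open>?S\<close> once its generators do.\<close>
    unfolding generating[unfolded bracket_generating_def, THEN spec, of q, symmetric]
    by (intro tv.span_minimal[OF _ sub] Un_least)
  then obtain a b c where "v = tscale a (X1 q) + tscale b (X2 q) + tscale c (lie_bracket A X1 X2 q)"
    using v by blast
  then have "\<forall>f. v f = (\<Sum>i\<in>UNIV. (if i = 1 then a else if i = 2 then b else c) * bracket_frame X1 X2 i q f)"
    by (simp add: sum_3 tscale_def)
  then show "\<exists>c. \<forall>f. v f = (\<Sum>i\<in>UNIV. c i * bracket_frame X1 X2 i q f)"
    by (rule exI[of _ "\<lambda>i. if i = 1 then a else if i = 2 then b else c"])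
qed

end

section \<open>Affine connections\<close>

lemma fscale_apply [simp]: "fscale f V p h = f p * V p h"
  by (simp add: fscale_def tscale_def)

locale affine_3manifold = smooth_3manifold A
  for A :: "('a::{t2_space, second_countable_topology}) chart set" +
  fixes nabla :: "'a connection"
  assumes connection: "affine_connection A nabla"
begin

abbreviation "\<X> \<equiv> vfields A UNIV"

lemma nabla_vfields: "V \<in> \<X> \<Longrightarrow> W \<in> \<X> \<Longrightarrow> nabla V W \<in> \<X>"
  using connection unfolding affine_connection_def by (elim conjE) simp

lemma nabla_linear_left:
  assumes "V \<in> \<X>" "V' \<in> \<X>" "W \<in> \<X>" "smooth_fun A UNIV f" "smooth_fun A UNIV f'"
  shows "nabla (fscale f V + fscale f' V') W = fscale f (nabla V W) + fscale f' (nabla V' W)"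
  using connection[unfolded affine_connection_def, THEN conjunct2, THEN conjunct1, THEN bspec, OF assms(1),
      THEN bspec, OF assms(2), THEN bspec, OF assms(3), THEN spec, THEN spec, THEN mp, OF conjI[OF assms(4,5)]] .

lemma nabla_add_right:
  assumes "V \<in> \<X>" "W \<in> \<X>" "W' \<in> \<X>"
  shows "nabla V (W + W') = nabla V W + nabla V W'"
  using connection[unfolded affine_connection_def, THEN conjunct2, THEN conjunct2, THEN conjunct1,
      THEN bspec, OF assms(1), THEN bspec, OF assms(2), THEN bspec, OF assms(3)] .

lemma nabla_fscale_right:
  assumes "V \<in> \<X>" "W \<in> \<X>" "smooth_fun A UNIV f"
  shows "nabla V (fscale f W) = fscale (\<lambda>p. V p f) W + fscale f (nabla V W)"
  using connection[unfolded affine_connection_def, THEN conjunct2, THEN conjunct2, THEN conjunct2,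
      THEN bspec, OF assms(1), THEN bspec, OF assms(2), THEN spec, THEN mp, OF assms(3)] .

lemma smooth_fun_const: "smooth_fun A UNIV (\<lambda>p. c)"
  by (simp add: smooth_fun_UNIV smooth_near_const)

lemma vfields_global_fscale: "V \<in> \<X> \<Longrightarrow> smooth_fun A UNIV f \<Longrightarrow> fscale f V \<in> \<X>"
  by (rule vfields_fscale) (simp_all add: smooth_fun_UNIV)

lemma nabla_fscale_left:
  assumes "V \<in> \<X>" "W \<in> \<X>" "smooth_fun A UNIV f"
  shows "nabla (fscale f V) W = fscale f (nabla V W)"
proof -
  have "fscale f V + fscale (\<lambda>p. 0) V = fscale f V" for V :: "'a vfield" by (simp add: fun_eq_iff)
  then show ?thesis
    using nabla_linear_left[OF assms(1,1,2,3) smooth_fun_const[of 0]] by simp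
qed

lemma nabla_add_left:
  assumes "V \<in> \<X>" "V' \<in> \<X>" "W \<in> \<X>"
  shows "nabla (V + V') W = nabla V W + nabla V' W"
proof -
  have "fscale (\<lambda>p. 1) V = V" for V :: "'a vfield" by (simp add: fun_eq_iff)
  then show ?thesis
    using nabla_linear_left[OF assms smooth_fun_const[of 1] smooth_fun_const[of 1]] by simp
qed

lemma nabla_diff_right:
  assumes "V \<in> \<X>" "W \<in> \<X>" "W' \<in> \<X>"
  shows "nabla V (W - W') = nabla V W - nabla V W'"
  using nabla_add_right[OF assms(1) vfields_minus[OF open_UNIV assms(2,3)] assms(3)] by simp

lemma nabla_diff_left:
  assumes "V \<in> \<X>" "V' \<in> \<X>" "W \<in> \<X>"
  shows "nabla (V - V') W = nabla V W - nabla V' W"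
  using nabla_add_left[OF vfields_minus[OF open_UNIV assms(1,2)] assms(2,3)] by simp

text \<open>A field vanishing near \<open>p\<close> is unchanged by a factor that is \<open>0\<close> at \<open>p\<close> and \<open>1\<close> wherever the field is nonzero.\<close>

lemma cutoff_vanishing:
  assumes Z: "\<forall>\<^sub>F q in nhds p. Z q = (0 :: 'a tvec)"
  obtains k where "smooth_fun A UNIV k" "k p = 0" "fscale k Z = Z"
proof -
  obtain S where S: "open S" "p \<in> S" "\<And>q. q \<in> S \<Longrightarrow> Z q = 0"
    using Z unfolding eventually_nhds by blast
  obtain h K where h: "smooth_fun A UNIV h" "closed K" "K \<subseteq> S" "\<And>q. q \<notin> K \<Longrightarrow> h q = 0"
    "\<forall>\<^sub>F q in nhds p. h q = 1"
    using bump_function[OF S(1,2)] by blast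
  show ?thesis
  proof (rule that[of "\<lambda>q. 1 - h q"])
    show "smooth_fun A UNIV (\<lambda>q. 1 - h q)"
      using h(1) unfolding smooth_fun_UNIV by (auto intro: smooth_near_diff smooth_near_const)
    show "1 - h p = 0" using eventually_nhds_x_imp_x[OF h(5)] by simp
    show "fscale (\<lambda>q. 1 - h q) Z = Z"
    proof (intro ext)
      fix q f
      show "fscale (\<lambda>q. 1 - h q) Z q f = Z q f"
        by (cases "q \<in> S") (use S(3) h(3,4) in auto)
    qed
  qed
qed

lemma nabla_local_right:
  assumes V: "V \<in> \<X>" and W: "W \<in> \<X>" "W' \<in> \<X>" and eq: "\<forall>\<^sub>F q in nhds p. W q = W' q"
  shows "nabla V W p = nabla V W' p"
proof -
  let ?Z = "W - W'"
  have Z: "?Z \<in> \<X>" by (rule vfields_minus[OF open_UNIV W])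
  have ev: "\<forall>\<^sub>F q in nhds p. ?Z q = 0" using eq by eventually_elim simp
  obtain k where k: "smooth_fun A UNIV k" "k p = 0" "fscale k ?Z = ?Z"
    by (rule cutoff_vanishing[OF ev])
  \<comment> \<open>With \<open>?Z = k ?Z\<close>, the Leibniz rule leaves a multiple of
    \<open>?Z p\<close> and a multiple of \<open>k p\<close>, both zero.\<close>
  have "nabla V ?Z p f = 0" for f
    using fun_cong[OF fun_cong[OF nabla_fscale_right[OF V Z k(1)], of p], of f] k(2,3)
      eventually_nhds_x_imp_x[OF ev] by simp
  then show ?thesis
    using nabla_diff_right[OF V W] by (simp add: fun_eq_iff)
qed

lemma nabla_local_left:
  assumes W: "W \<in> \<X>" and V: "V \<in> \<X>" "V' \<in> \<X>" and eq: "\<forall>\<^sub>F q in nhds p. V q = V' q"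
  shows "nabla V W p = nabla V' W p"
proof -
  let ?Z = "V - V'"
  have Z: "?Z \<in> \<X>" by (rule vfields_minus[OF open_UNIV V])
  have ev: "\<forall>\<^sub>F q in nhds p. ?Z q = 0" using eq by eventually_elim simp
  obtain k where k: "smooth_fun A UNIV k" "k p = 0" "fscale k ?Z = ?Z"
    by (rule cutoff_vanishing[OF ev])
  have "nabla ?Z W p f = 0" for f
    using fun_cong[OF fun_cong[OF nabla_fscale_left[OF Z W k(1)], of p], of f] k(2,3) by simp
  then show ?thesis
    using nabla_diff_left[OF V W] by (simp add: fun_eq_iff)
qed

text \<open>Locality in both arguments makes the value independent of the extensions, so the
  definite description denotes and any convenient extension computes it.\<close>

lemma restrict_connection_eq:
  assumes p: "p \<in> U" and V': "V' \<in> \<X>" and W': "W' \<in> \<X>"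
    and eq: "\<forall>\<^sub>F q in nhds p. V' q = V q \<and> W' q = W q"
  shows "restrict_connection A nabla U V W p = nabla V' W' p"
proof -
  have "(THE z. \<exists>V'\<in>\<X>. \<exists>W'\<in>\<X>. (\<forall>\<^sub>F q in nhds p. V' q = V q \<and> W' q = W q) \<and> z = nabla V' W' p)
      = nabla V' W' p"
  proof (rule the_equality)
    show "\<exists>V''\<in>\<X>. \<exists>W''\<in>\<X>. (\<forall>\<^sub>F q in nhds p. V'' q = V q \<and> W'' q = W q) \<and> nabla V' W' p = nabla V'' W'' p"
      using V' W' eq by blast
    fix z
    assume "\<exists>V''\<in>\<X>. \<exists>W''\<in>\<X>. (\<forall>\<^sub>F q in nhds p. V'' q = V q \<and> W'' q = W q) \<and> z = nabla V'' W'' p"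
    then obtain V'' W'' where *: "V'' \<in> \<X>" "W'' \<in> \<X>" "\<forall>\<^sub>F q in nhds p. V'' q = V q \<and> W'' q = W q"
      "z = nabla V'' W'' p" by blast
    have "\<forall>\<^sub>F q in nhds p. V'' q = V' q" "\<forall>\<^sub>F q in nhds p. W'' q = W' q"
      using *(3) eq by (eventually_elim, simp)+
    then show "z = nabla V' W' p"
      using *(4) nabla_local_left[OF *(2,1) V'] nabla_local_right[OF V' *(2) W'] by simp
  qed
  then show ?thesis using p by (simp add: restrict_connection_def)
qed

text \<open>For global fields the inner derivative \<open>nabla Y' V\<close> is itself a global
  field agreeing with the restricted one on \<open>U\<close>, hence an admissible extension for the
  outer derivative.\<close>

lemma horizontal_curvature_global:
  assumes U: "open U" "p \<in> U" and X: "X1 \<in> \<X>" "X2 \<in> \<X>" and V: "V \<in> \<X>"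
  shows "horizontal_curvature A nabla U X1 X2 V p = curvature A nabla X1 X2 V p"
proof -
  have r: "restrict_connection A nabla U Y W q = nabla Y W q" if "q \<in> U" "Y \<in> \<X>" "W \<in> \<X>" for q Y W
    by (rule restrict_connection_eq[OF that]) simp
  have rr: "restrict_connection A nabla U Y (restrict_connection A nabla U Y' V) p = nabla Y (nabla Y' V) p"
    if "Y \<in> \<X>" "Y' \<in> \<X>" for Y Y'
  proof (rule restrict_connection_eq[OF U(2) that(1) nabla_vfields[OF that(2) V]])
    show "\<forall>\<^sub>F q in nhds p. Y q = Y q \<and> nabla Y' V q = restrict_connection A nabla U Y' V q"
      using eventually_nhds_in_open[OF U] by eventually_elim (simp add: r that V)
  qed
  show ?thesis
    unfolding horizontal_curvature_def curvature_def
    by (simp add: rr X r U V lie_bracket_vfields)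
qed

section \<open>Expansion in a frame and tensoriality\<close>

definition combination :: "(3 \<Rightarrow> 'a \<Rightarrow> real) \<Rightarrow> (3 \<Rightarrow> 'a vfield) \<Rightarrow> 'a vfield" where
  "combination C Z = fscale (C 1) (Z 1) + (fscale (C 2) (Z 2) + fscale (C 3) (Z 3))"

lemma combination_apply: "combination C Z q f = (\<Sum>i\<in>UNIV. C i q * Z i q f)"
  by (simp add: combination_def sum_3)

lemma combination_vfields:
  assumes "\<And>i. smooth_fun A UNIV (C i)" "\<And>i. Z i \<in> \<X>"
  shows "combination C Z \<in> \<X>"
  unfolding combination_def by (intro vfields_add vfields_global_fscale assms open_UNIV)

lemma nabla_combination_left:
  assumes C: "\<And>i. smooth_fun A UNIV (C i)" and Z: "\<And>i. Z i \<in> \<X>" and W: "W \<in> \<X>"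
  shows "nabla (combination C Z) W p f = (\<Sum>i\<in>UNIV. C i p * nabla (Z i) W p f)"
  unfolding combination_def
  by (simp add: nabla_add_left nabla_fscale_left vfields_add vfields_global_fscale C Z W sum_3)

lemma nabla_combination_right:
  assumes C: "\<And>i. smooth_fun A UNIV (C i)" and Z: "\<And>i. Z i \<in> \<X>" and V: "V \<in> \<X>"
  shows "nabla V (combination C Z) p f = (\<Sum>i\<in>UNIV. V p (C i) * Z i p f + C i p * nabla V (Z i) p f)"
  unfolding combination_def
  by (simp add: nabla_add_right nabla_fscale_right vfields_add vfields_global_fscale C Z V sum_3)

lemma nabla_expand_right:
  fixes C :: "3 \<Rightarrow> 'a \<Rightarrow> real"
  assumes C: "\<And>i. smooth_fun A UNIV (C i)" and Z: "\<And>i. Z i \<in> \<X>" and V: "V \<in> \<X>" and W: "W \<in> \<X>"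
    and eq: "\<forall>\<^sub>F q in nhds p. \<forall>f. W q f = (\<Sum>i\<in>UNIV. C i q * Z i q f)"
  shows "nabla V W p f = (\<Sum>i\<in>UNIV. V p (C i) * Z i p f + C i p * nabla V (Z i) p f)"
proof -
  have "\<forall>\<^sub>F q in nhds p. W q = combination C Z q"
    using eq by eventually_elim (simp add: fun_eq_iff combination_apply)
  then have "nabla V W p = nabla V (combination C Z) p"
    by (rule nabla_local_right[OF V W combination_vfields[OF C Z]])
  then show ?thesis by (simp add: nabla_combination_right[OF C Z V])
qed

lemma frame_on_vfields: "frame_on U Z \<Longrightarrow> Z i \<in> \<X>"
  by (simp add: frame_on_def)

text \<open>Tensoriality in the direction: a smooth expansion of \<open>V\<close> near
  \<open>p\<close> passes through \<open>nabla\<close> by linearity over functions, and independence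
  of the frame identifies its coefficients at \<open>p\<close> with the given
  \<open>c\<close>.\<close>

lemma nabla_frame_left:
  assumes Z: "frame_on U Z" and p: "p \<in> U" and V: "V \<in> \<X>" and W: "W \<in> \<X>"
    and c: "\<And>f. V p f = (\<Sum>i\<in>UNIV. c i * Z i p f)"
  shows "nabla V W p f = (\<Sum>i\<in>UNIV. c i * nabla (Z i) W p f)"
proof -
  note Zv = frame_on_vfields[OF Z]
  obtain C where C: "\<And>i. smooth_fun A UNIV (C i)"
    "\<forall>\<^sub>F q in nhds p. \<forall>f. V q f = (\<Sum>i\<in>UNIV. C i q * Z i q f)"
    using frame_smooth_coefficients[OF Z p V] by blast
  have "\<forall>\<^sub>F q in nhds p. V q = combination C Z q"
    using C(2) by eventually_elim (simp add: fun_eq_iff combination_apply)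
  then have "nabla V W p = nabla (combination C Z) W p"
    by (rule nabla_local_left[OF W V combination_vfields[OF C(1) Zv]])
  moreover have "C i p = c i" for i
    by (rule frame_independent[OF Z p]) (use eventually_nhds_x_imp_x[OF C(2)] c in simp)
  ultimately show ?thesis by (simp add: nabla_combination_left[OF C(1) Zv W])
qed

text \<open>Hence \<open>V (\<alpha> W) - \<alpha> (\<nabla>\<^sub>V W)\<close> with \<open>\<alpha>\<close> an exact form depends on \<open>W p\<close> only.\<close>

lemma nabla_right_vanishing:
  assumes Z: "frame_on U Z" and p: "p \<in> U" and V: "V \<in> \<X>" and W: "W \<in> \<X>"
    and 0: "W p = 0" and f: "smooth_near A p f"
  shows "nabla V W p f = V p (\<lambda>q. W q f)"
proof -
  note Zv = frame_on_vfields[OF Z]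
  obtain C where C: "\<And>i. smooth_fun A UNIV (C i)"
    "\<forall>\<^sub>F q in nhds p. \<forall>f. W q f = (\<Sum>i\<in>UNIV. C i q * Z i q f)"
    using frame_smooth_coefficients[OF Z p W] by blast
  have C0: "C i p = 0" for i
    by (rule frame_independent[OF Z p, where b = "\<lambda>i. 0"])
      (use eventually_nhds_x_imp_x[OF C(2)] 0 in simp)
  have s: "smooth_near A p (C i)" "smooth_near A p (\<lambda>q. Z i q f)" for i
    using C(1) smooth_fun_UNIV vfields_smooth[OF Zv open_UNIV UNIV_I f] by auto
  note Vp = vfields_tangent[OF V UNIV_I, of p]
  have "V p (\<lambda>q. W q f) = V p (\<lambda>q. \<Sum>i\<in>UNIV. C i q * Z i q f)"
    by (rule tangent_cong[OF Vp vfields_smooth[OF W open_UNIV UNIV_I f]])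
      (use C(2) in \<open>auto elim: eventually_mono\<close>)
  \<comment> \<open>Since all \<open>C i\<close> vanish at \<open>p\<close>, only the derivatives of
    the coefficients survive the product rule, and these are the same terms as in the Leibniz rule
    for \<open>nabla\<close>.\<close>
  also have "\<dots> = (\<Sum>i\<in>UNIV. V p (C i) * Z i p f)"
    unfolding sum_3
    by (simp add: tangent_add[OF Vp] tangent_mult[OF Vp] smooth_near_add smooth_near_mult s C0)
  finally show ?thesis
    using nabla_expand_right[OF C(1) Zv V W C(2)] C0 by simp
qed

section \<open>Exact one-forms \<open>dy\<close> and their covariant derivatives\<close>

definition exact_form :: "('a \<Rightarrow> real) \<Rightarrow> 'a \<Rightarrow> 'a covec" where
  "exact_form y p v = v y"

lemma exact_form_one_forms:
  assumes "smooth_fun A UNIV y"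
  shows "exact_form y \<in> one_forms A"
  unfolding one_forms_def mem_Collect_eq
proof (intro conjI allI impI)
  show "exact_form y p \<in> cotangent_space A p" for p
    by (simp add: cotangent_space_def exact_form_def tscale_def)
  fix U V assume "open U \<and> V \<in> vfields A U"
  then show "smooth_fun A U (\<lambda>q. exact_form y q (V q))"
    unfolding exact_form_def using vfields_smooth_fun smooth_fun_subset[OF assms subset_UNIV] by blast
qed

text \<open>Two fields with the same value at \<open>p\<close> differ by one that vanishes there,
  and such a field contributes nothing. This gives the uniqueness behind the definite
  description.\<close>

lemma cov_deriv_exact_form:
  assumes Z: "frame_on U Z" and p: "p \<in> U" and V: "V \<in> \<X>" and W: "W \<in> \<X>"
    and y: "smooth_fun A UNIV y"
  shows "cov_deriv_form A nabla V (exact_form y) p (W p) = V p (\<lambda>q. W q y) - nabla V W p y"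
  unfolding cov_deriv_form_def exact_form_def
proof (rule the_equality)
  show "\<exists>W'\<in>\<X>. W' p = W p \<and> V p (\<lambda>q. W q y) - nabla V W p y = V p (\<lambda>q. W' q y) - nabla V W' p y"
    using W by blast
  fix c assume "\<exists>W'\<in>\<X>. W' p = W p \<and> c = V p (\<lambda>q. W' q y) - nabla V W' p y"
  then obtain W' where W': "W' \<in> \<X>" "W' p = W p" "c = V p (\<lambda>q. W' q y) - nabla V W' p y" by blast
  have yp: "smooth_near A p y" using y smooth_fun_UNIV by blast
  have "nabla V (W' - W) p y = V p (\<lambda>q. (W' - W) q y)"
    by (rule nabla_right_vanishing[OF Z p V vfields_minus[OF open_UNIV W'(1) W] _ yp]) (simp add: W'(2))
  also have "\<dots> = V p (\<lambda>q. W' q y) - V p (\<lambda>q. W q y)"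
    using tangent_diff[OF vfields_tangent[OF V UNIV_I] vfields_smooth[OF W'(1) open_UNIV UNIV_I yp]
        vfields_smooth[OF W open_UNIV UNIV_I yp]] by simp
  finally show "c = V p (\<lambda>q. W q y) - nabla V W p y"
    using nabla_diff_right[OF V W'(1) W] W'(3) by simp
qed

lemma frame_tangent_extends:
  assumes Z: "frame_on U Z" and p: "p \<in> U" and v: "v \<in> tangent_space A p"
  obtains W where "W \<in> \<X>" "W p = v"
proof -
  obtain c where c: "\<And>f. v f = (\<Sum>i\<in>UNIV. c i * Z i p f)"
    using Z p v unfolding frame_on_def by blast
  show ?thesis
    by (rule that[of "combination (\<lambda>i q. c i) Z"])
      (auto simp: fun_eq_iff combination_apply c intro!: combination_vfields smooth_fun_const frame_on_vfields[OF Z])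
qed

text \<open>\<open>associated_cometric\<close> determines \<open>g\<close> on genuine covectors
  only, so linearity must be known before the co-metric formula may be applied to this
  derivative.\<close>

lemma cov_deriv_exact_form_cotangent:
  assumes Z: "frame_on U Z" and p: "p \<in> U" and V: "V \<in> \<X>" and y: "smooth_fun A UNIV y"
  shows "cov_deriv_form A nabla V (exact_form y) p \<in> cotangent_space A p"
  unfolding cotangent_space_def mem_Collect_eq
proof (intro ballI allI)
  fix v w a b assume "v \<in> tangent_space A p" "w \<in> tangent_space A p"
  obtain V1 where V1: "V1 \<in> \<X>" "V1 p = v" by (rule frame_tangent_extends[OF Z p \<open>v \<in> tangent_space A p\<close>])
  obtain W1 where W1: "W1 \<in> \<X>" "W1 p = w" by (rule frame_tangent_extends[OF Z p \<open>w \<in> tangent_space A p\<close>])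
  let ?Y = "fscale (\<lambda>q. a) V1 + fscale (\<lambda>q. b) W1"
  have Y: "?Y \<in> \<X>" by (intro vfields_add vfields_global_fscale smooth_fun_const V1 W1 open_UNIV)
  have Yp: "?Y p = tscale a v + tscale b w" using V1 W1 by (simp add: fscale_def)
  note Vp = vfields_tangent[OF V UNIV_I, of p]
  have yp: "smooth_near A p y" using y smooth_fun_UNIV by blast
  have eq1: "V p (\<lambda>q. ?Y q y) = a * V p (\<lambda>q. V1 q y) + b * V p (\<lambda>q. W1 q y)"
    using tangent_linear[OF Vp vfields_smooth[OF V1(1) open_UNIV UNIV_I yp]
        vfields_smooth[OF W1(1) open_UNIV UNIV_I yp]] by simp
  have eq2: "nabla V ?Y p y = a * nabla V V1 p y + b * nabla V W1 p y"
    by (simp add: nabla_add_right nabla_fscale_right V V1 W1 vfields_global_fscale smooth_fun_const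
        tangent_const[OF Vp])
  show "cov_deriv_form A nabla V (exact_form y) p (tscale a v + tscale b w) =
      a * cov_deriv_form A nabla V (exact_form y) p v + b * cov_deriv_form A nabla V (exact_form y) p w"
    unfolding cov_deriv_exact_form[OF Z p V Y y, unfolded Yp] cov_deriv_exact_form[OF Z p V V1(1) y, unfolded V1(2)]
      cov_deriv_exact_form[OF Z p V W1(1) y, unfolded W1(2)] eq1 eq2
    by (simp add: algebra_simps)
qed

end

section \<open>Compatible connections\<close>

locale compatible_connection = oriented_sub_riemannian A H ip pos + affine_3manifold A nabla
  for A :: "('a::{t2_space, second_countable_topology}) chart set"
    and H :: "'a distribution" and ip :: "'a fiber_metric"
    and pos :: "'a \<Rightarrow> 'a tvec \<Rightarrow> 'a tvec \<Rightarrow> bool"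
    and nabla :: "'a connection" +
  fixes g :: "'a cometric"
  assumes cometric: "associated_cometric A H ip g"
    and compatible: "compatible A g nabla"
begin

text \<open>In \<open>(\<nabla>_V g)(dy, dz)\<close> the terms differentiating \<open>X1 y\<close>,
  \<open>X2 y\<close>, \<open>X1 z\<close>, \<open>X2 z\<close> cancel. What remains is the
  covariant derivative of \<open>X1 \<otimes> X1 + X2 \<otimes> X2\<close> paired with
  \<open>dy\<close> and \<open>dz\<close>.\<close>

lemma compatible_exact_forms:
  assumes F: "adapted_frame U X1 X2" and p: "p \<in> U" and V: "V \<in> \<X>"
    and y: "smooth_fun A UNIV y" and z: "smooth_fun A UNIV z"
  shows "nabla V X1 p y * X1 p z + X1 p y * nabla V X1 p z
    + nabla V X2 p y * X2 p z + X2 p y * nabla V X2 p z = 0"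
proof -
  note Z = adapted_frame_frame_on[OF F]
  have U: "open U" and X: "X1 \<in> \<X>" "X2 \<in> \<X>" and on: "orthonormal_frame A H ip U X1 X2"
    using Z F unfolding frame_on_def adapted_frame_def oriented_orthonormal_frame_def by auto
  have g: "g q \<alpha> \<beta> = \<alpha> (X1 q) * \<beta> (X1 q) + \<alpha> (X2 q) * \<beta> (X2 q)"
    if "q \<in> U" "\<alpha> \<in> cotangent_space A q" "\<beta> \<in> cotangent_space A q" for q \<alpha> \<beta>
    using cometric on that unfolding associated_cometric_def by blast
  have d: "exact_form f q \<in> cotangent_space A q" if "smooth_fun A UNIV f" for f q
    using exact_form_one_forms[OF that] by (simp add: one_forms_def)
  note cov = cov_deriv_exact_form[OF Z p V]
  note covc = cov_deriv_exact_form_cotangent[OF Z p V]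
  note Vp = vfields_tangent[OF V UNIV_I, of p]
  have s: "smooth_near A p (\<lambda>q. X q f)" if "X \<in> \<X>" "smooth_fun A UNIV f" for X f
    using vfields_smooth[OF that(1) open_UNIV UNIV_I] that(2) smooth_fun_UNIV by blast
  note sm = s[OF X(1) y] s[OF X(1) z] s[OF X(2) y] s[OF X(2) z]
  have "\<forall>\<^sub>F q in nhds p. X1 q y * X1 q z + X2 q y * X2 q z = g q (exact_form y q) (exact_form z q)"
    using eventually_nhds_in_open[OF U p] by eventually_elim (simp add: g d y z exact_form_def)
  then have "V p (\<lambda>q. g q (exact_form y q) (exact_form z q)) = V p (\<lambda>q. X1 q y * X1 q z + X2 q y * X2 q z)"
    by (intro tangent_cong[OF Vp, symmetric] smooth_near_add smooth_near_mult sm)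
  also have "\<dots> = X1 p y * V p (\<lambda>q. X1 q z) + V p (\<lambda>q. X1 q y) * X1 p z
      + (X2 p y * V p (\<lambda>q. X2 q z) + V p (\<lambda>q. X2 q y) * X2 p z)"
    by (simp add: tangent_add[OF Vp] tangent_mult[OF Vp] smooth_near_mult sm)
  moreover have "g p (cov_deriv_form A nabla V (exact_form y) p) (exact_form z p) =
      (V p (\<lambda>q. X1 q y) - nabla V X1 p y) * X1 p z + (V p (\<lambda>q. X2 q y) - nabla V X2 p y) * X2 p z"
    by (simp add: g[OF p covc[OF y] d[OF z]] cov X y exact_form_def)
  moreover have "g p (exact_form y p) (cov_deriv_form A nabla V (exact_form z) p) =
      X1 p y * (V p (\<lambda>q. X1 q z) - nabla V X1 p z) + X2 p y * (V p (\<lambda>q. X2 q z) - nabla V X2 p z)"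
    by (simp add: g[OF p d[OF y] covc[OF z]] cov X z exact_form_def)
  moreover have "cov_deriv_cometric A nabla V g (exact_form y) (exact_form z) p = 0"
    using compatible[unfolded compatible_def, THEN bspec, OF V, THEN bspec, OF exact_form_one_forms[OF y],
        THEN bspec, OF exact_form_one_forms[OF z]] by simp
  ultimately show ?thesis
    unfolding cov_deriv_cometric_def by (simp add: algebra_simps)
qed

lemma connection_form:
  assumes F: "adapted_frame U X1 X2" and p: "p \<in> U" and V: "V \<in> \<X>"
  obtains \<omega> where "\<And>f. nabla V X1 p f = \<omega> * X2 p f" "\<And>f. nabla V X2 p f = - \<omega> * X1 p f"
proof -
  let ?Z = "bracket_frame X1 X2"
  note Z = adapted_frame_frame_on[OF F]
  have X: "X1 \<in> \<X>" "X2 \<in> \<X>" using F by (simp_all add: adapted_frame_def)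
  obtain a where a: "\<And>f. nabla V X1 p f = (\<Sum>i\<in>UNIV. a i * ?Z i p f)"
    using Z p vfields_tangent[OF nabla_vfields[OF V X(1)], of p] unfolding frame_on_def by blast
  obtain b where b: "\<And>f. nabla V X2 p f = (\<Sum>i\<in>UNIV. b i * ?Z i p f)"
    using Z p vfields_tangent[OF nabla_vfields[OF V X(2)], of p] unfolding frame_on_def by blast
  have "\<exists>y. smooth_fun A UNIV y \<and> (\<forall>i. ?Z i p y = (if i = j then 1 else 0))" for j :: 3
    by (rule frame_dual_function[OF Z p, of "\<lambda>i. if i = j then 1 else 0"]) blast
  then obtain y where y: "\<And>j. smooth_fun A UNIV (y j)" "\<And>i j. ?Z i p (y j) = (if i = j then 1 else 0)"
    by metis
  have ab: "nabla V X1 p (y j) = a j" "nabla V X2 p (y j) = b j" for j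
    by (simp_all add: a b y(2) if_distrib[of "(*) _"] cong: if_cong)
  have Xy: "X1 p (y j) = (if 1 = j then 1 else 0)" "X2 p (y j) = (if 2 = j then 1 else 0)" for j
    using y(2)[of 1 j] y(2)[of 2 j] by simp_all
  have eq: "a j * X1 p (y k) + X1 p (y j) * a k + b j * X2 p (y k) + X2 p (y j) * b k = 0" for j k
    using compatible_exact_forms[OF F p V y(1) y(1), of j k] by (simp only: ab)
  \<comment> \<open>On dual functions the pairs (1,1) and (2,2) kill the diagonal terms, (3,1) and
    (3,2) kill the transverse components, and (1,2) gives skewness.\<close>
  have "a 1 = 0" "a 3 = 0" "b 2 = 0" "b 3 = 0" "b 1 = - a 2"
    using eq[of 1 1] eq[of 3 1] eq[of 2 2] eq[of 3 2] eq[of 1 2] by (simp_all add: Xy)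
  then show ?thesis
    by (intro that[of "a 2"]) (simp_all add: a b sum_3)
qed

end

section \<open>Two compatible connections\<close>

text \<open>The two extra assumptions are the right-hand side of the equivalence; the locale serves
  the implication from it to equality.\<close>

locale two_compatible_connections =
  n1: compatible_connection A H ip pos nabla g + n2: compatible_connection A H ip pos nabla' g
  for A :: "('a::{t2_space, second_countable_topology}) chart set"
    and H :: "'a distribution" and ip :: "'a fiber_metric"
    and pos :: "'a \<Rightarrow> 'a tvec \<Rightarrow> 'a tvec \<Rightarrow> bool"
    and nabla nabla' :: "'a connection" and g :: "'a cometric" +
  assumes torsion: "\<And>V W. V \<in> vfields A UNIV \<Longrightarrow> W \<in> vfields A UNIV \<Longrightarrow>
      torsion A nabla V W = torsion A nabla' V W"
    and horizontal_curvature: "\<And>U X1 X2 V p. oriented_orthonormal_frame A H ip pos U X1 X2 \<Longrightarrow>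
      V \<in> vfields A U \<Longrightarrow> p \<in> U \<Longrightarrow>
      horizontal_curvature A nabla U X1 X2 V p = horizontal_curvature A nabla' U X1 X2 V p"
begin

text \<open>The Lie bracket is common to both torsions and cancels.\<close>

lemma difference_symmetric:
  assumes "V \<in> n1.\<X>" "W \<in> n1.\<X>"
  shows "nabla V W p f - nabla' V W p f = nabla W V p f - nabla' W V p f"
  using fun_cong[OF fun_cong[OF torsion[OF assms], of p], of f] by (simp add: torsion_def)

text \<open>The terms \<open>V p (C i) * Z i p f\<close> of the Leibniz rule do not involve the
  connection and cancel in the difference, which therefore sees \<open>W\<close> only through
  \<open>W p\<close>.\<close>

lemma difference_tensorial:
  assumes Z: "n1.frame_on U Z" and p: "p \<in> U" and V: "V \<in> n1.\<X>" and W: "W \<in> n1.\<X>"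
    and c: "\<And>f. W p f = (\<Sum>i\<in>UNIV. c i * Z i p f)"
  shows "nabla V W p f - nabla' V W p f = (\<Sum>i\<in>UNIV. c i * (nabla V (Z i) p f - nabla' V (Z i) p f))"
proof -
  note Zv = n1.frame_on_vfields[OF Z]
  obtain C where C: "\<And>i. smooth_fun A UNIV (C i)"
    "\<forall>\<^sub>F q in nhds p. \<forall>f. W q f = (\<Sum>i\<in>UNIV. C i q * Z i q f)"
    using n1.frame_smooth_coefficients[OF Z p W] by blast
  have "C i p = c i" for i
    by (rule n1.frame_independent[OF Z p]) (use eventually_nhds_x_imp_x[OF C(2)] c in simp)
  then show ?thesis
    unfolding n1.nabla_expand_right[OF C(1) Zv V W C(2)] n2.nabla_expand_right[OF C(1) Zv V W C(2)]
    by (simp add: sum_3 algebra_simps)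
qed

section \<open>Computation in an adapted frame\<close>

context
  fixes U X1 X2
  assumes F: "n1.adapted_frame U X1 X2"
begin

abbreviation "X3 \<equiv> lie_bracket A X1 X2"

lemma adapted_vfields: "X1 \<in> n1.\<X>" "X2 \<in> n1.\<X>" "X3 \<in> n1.\<X>" "open U"
  using F n1.lie_bracket_vfields[OF open_UNIV, of X1 X2] n1.adapted_frame_frame_on[OF F]
  by (auto simp: n1.adapted_frame_def n1.frame_on_def)

lemma adapted_curvature:
  assumes p: "p \<in> U" and V: "V \<in> n1.\<X>"
  shows "nabla X1 (nabla X2 V) p f - nabla X2 (nabla X1 V) p f - nabla X3 V p f =
    nabla' X1 (nabla' X2 V) p f - nabla' X2 (nabla' X1 V) p f - nabla' X3 V p f"
proof -
  have "horizontal_curvature A nabla U X1 X2 V p = horizontal_curvature A nabla' U X1 X2 V p"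
    by (rule horizontal_curvature[OF _ n1.vfields_subset[OF V] p])
      (use F in \<open>auto simp: n1.adapted_frame_def\<close>)
  then have "curvature A nabla X1 X2 V p = curvature A nabla' X1 X2 V p"
    using n1.horizontal_curvature_global[OF adapted_vfields(4) p adapted_vfields(1,2) V]
      n2.horizontal_curvature_global[OF adapted_vfields(4) p adapted_vfields(1,2) V] by simp
  from fun_cong[OF this, of f] show ?thesis by (simp add: curvature_def)
qed

text \<open>The symmetric difference tensor is skew on \<open>H\<close>, which makes it vanish on pairs of horizontal vectors.\<close>

lemma horizontal_agree:
  assumes p: "p \<in> U" and V: "V \<in> {X1, X2}" and W: "W \<in> {X1, X2}"
  shows "nabla V W p = nabla' V W p"
proof -
  note X = adapted_vfields
  let ?Z = "n1.bracket_frame X1 X2"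
  note Z = n1.adapted_frame_frame_on[OF F]
  obtain a where a: "\<And>f. nabla X1 X1 p f = a * X2 p f" "\<And>f. nabla X1 X2 p f = - a * X1 p f"
    using n1.connection_form[OF F p X(1)] by blast
  obtain b where b: "\<And>f. nabla X2 X1 p f = b * X2 p f" "\<And>f. nabla X2 X2 p f = - b * X1 p f"
    using n1.connection_form[OF F p X(2)] by blast
  obtain a' where a': "\<And>f. nabla' X1 X1 p f = a' * X2 p f" "\<And>f. nabla' X1 X2 p f = - a' * X1 p f"
    using n2.connection_form[OF F p X(1)] by blast
  obtain b' where b': "\<And>f. nabla' X2 X1 p f = b' * X2 p f" "\<And>f. nabla' X2 X2 p f = - b' * X1 p f"
    using n2.connection_form[OF F p X(2)] by blast
  \<comment> \<open>\<open>D(X1, X2) = (a' - a) X1\<close> and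
    \<open>D(X2, X1) = (b - b') X2\<close>; by symmetry their difference is the null combination
    with these coefficients.\<close>
  let ?c = "\<lambda>i::3. if i = 1 then a' - a else if i = 2 then b' - b else 0"
  have "(\<Sum>i\<in>UNIV. ?c i * ?Z i p f) = (\<Sum>i\<in>UNIV. 0 * ?Z i p f)" for f
    using difference_symmetric[OF X(1,2), of p f] by (simp add: sum_3 a a' b b' algebra_simps)
  then have c: "?c i = 0" for i
    by (rule n1.frame_independent[OF Z p])
  have "a' = a" "b' = b" using c[of 1] c[of 2] by simp_all
  then have "nabla X1 X1 p = nabla' X1 X1 p" "nabla X1 X2 p = nabla' X1 X2 p"
    "nabla X2 X1 p = nabla' X2 X1 p" "nabla X2 X2 p = nabla' X2 X2 p"
    by (simp_all add: fun_eq_iff a a' b b')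
  then show ?thesis using V W by blast
qed

text \<open>The outer connection may be exchanged because \<open>nabla W X1\<close> is a multiple of
  \<open>X2\<close> at \<open>p\<close> and the difference vanishes on horizontal pairs. The inner
  one may be exchanged because the two fields agree on all of \<open>U\<close>, hence near
  \<open>p\<close>.\<close>

lemma horizontal_second_agree:
  assumes p: "p \<in> U" and V: "V \<in> {X1, X2}" and W: "W \<in> {X1, X2}"
  shows "nabla V (nabla W X1) p f = nabla' V (nabla' W X1) p f"
proof -
  note Z = n1.adapted_frame_frame_on[OF F]
  have v: "V \<in> n1.\<X>" "W \<in> n1.\<X>" "X1 \<in> n1.\<X>" using V W adapted_vfields by auto
  note W1 = n1.nabla_vfields[OF v(2,3)] n2.nabla_vfields[OF v(2,3)]
  obtain \<omega> where \<omega>: "\<And>f. nabla W X1 p f = \<omega> * X2 p f" "\<And>f. nabla W X2 p f = - \<omega> * X1 p f"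
    using n1.connection_form[OF F p v(2)] by blast
  have "nabla V (nabla W X1) p f - nabla' V (nabla W X1) p f =
      (\<Sum>i\<in>UNIV. (if i = 2 then \<omega> else 0) * (nabla V (n1.bracket_frame X1 X2 i) p f - nabla' V (n1.bracket_frame X1 X2 i) p f))"
    by (rule difference_tensorial[OF Z p v(1) W1(1)]) (simp add: sum_3 \<omega>)
  also have "\<dots> = 0"
    using horizontal_agree[OF p V, of X2] by (simp add: sum_3)
  finally have "nabla V (nabla W X1) p f = nabla' V (nabla W X1) p f" by simp
  moreover have "\<forall>\<^sub>F q in nhds p. nabla W X1 q = nabla' W X1 q"
    using eventually_nhds_in_open[OF adapted_vfields(4) p]
    by eventually_elim (rule horizontal_agree[OF _ W], simp_all)
  ultimately show ?thesis
    using n2.nabla_local_right[OF v(1) W1] by simp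
qed

lemma bracket_horizontal_agree:
  assumes p: "p \<in> U"
  shows "nabla X3 X1 p = nabla' X3 X1 p" "nabla X3 X2 p = nabla' X3 X2 p"
proof -
  note X = adapted_vfields
  let ?Z = "n1.bracket_frame X1 X2"
  note Z = n1.adapted_frame_frame_on[OF F]
  have eq: "nabla X3 X1 p f = nabla' X3 X1 p f" for f
    using adapted_curvature[OF p X(1), of f] horizontal_second_agree[OF p, of X1 X2 f]
      horizontal_second_agree[OF p, of X2 X1 f] by simp
  obtain a where a: "\<And>f. nabla X3 X1 p f = a * X2 p f" "\<And>f. nabla X3 X2 p f = - a * X1 p f"
    using n1.connection_form[OF F p X(3)] by blast
  obtain a' where a': "\<And>f. nabla' X3 X1 p f = a' * X2 p f" "\<And>f. nabla' X3 X2 p f = - a' * X1 p f"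
    using n2.connection_form[OF F p X(3)] by blast
  let ?c = "\<lambda>c i. if i = (2::3) then c else 0"
  have "(\<Sum>i\<in>UNIV. ?c a i * ?Z i p f) = (\<Sum>i\<in>UNIV. ?c a' i * ?Z i p f)" for f
    using eq[of f] by (simp add: sum_3 a a')
  then have "?c a 2 = ?c a' 2" by (rule n1.frame_independent[OF Z p])
  then have "a = a'" by simp
  then show "nabla X3 X1 p = nabla' X3 X1 p" "nabla X3 X2 p = nabla' X3 X2 p"
    by (simp_all add: fun_eq_iff a a')
qed

lemma horizontal_direction_agree:
  assumes p: "p \<in> U" and V: "V \<in> {X1, X2}" and W: "W \<in> n1.\<X>"
  shows "nabla V W p = nabla' V W p"
proof
  fix f
  note X = adapted_vfields
  let ?Z = "n1.bracket_frame X1 X2"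
  note Z = n1.adapted_frame_frame_on[OF F]
  have v: "V \<in> n1.\<X>" using V X by auto
  obtain c where c: "\<And>f. W p f = (\<Sum>i\<in>UNIV. c i * ?Z i p f)"
    using Z p n1.vfields_tangent[OF W, of p] unfolding n1.frame_on_def by blast
  have "nabla V X3 p f - nabla' V X3 p f = nabla X3 V p f - nabla' X3 V p f"
    by (rule difference_symmetric[OF v X(3)])
  also have "\<dots> = 0" using V bracket_horizontal_agree[OF p] by auto
  finally have "nabla V X3 p f = nabla' V X3 p f" by simp
  then show "nabla V W p f = nabla' V W p f"
    using difference_tensorial[OF Z p v W c, of f] horizontal_agree[OF p V, of X1] horizontal_agree[OF p V, of X2]
    by (simp add: sum_3)
qed

text \<open>The field \<open>nabla W X3\<close> need not be horizontal, so agreement on horizontal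
  pairs is too weak here. The outer exchange uses agreement in horizontal directions on arbitrary
  fields; the curvature of \<open>X3\<close> then has one term left to compare.\<close>

lemma bracket_bracket_agree:
  assumes p: "p \<in> U"
  shows "nabla X3 X3 p f = nabla' X3 X3 p f"
proof -
  note X = adapted_vfields
  have "nabla V (nabla W X3) p = nabla' V (nabla' W X3) p" if V: "V \<in> {X1, X2}" and W: "W \<in> {X1, X2}" for V W
  proof -
    have v: "V \<in> n1.\<X>" "W \<in> n1.\<X>" using V W X by auto
    note W3 = n1.nabla_vfields[OF v(2) X(3)] n2.nabla_vfields[OF v(2) X(3)]
    have "\<forall>\<^sub>F q in nhds p. nabla W X3 q = nabla' W X3 q"
      using eventually_nhds_in_open[OF X(4) p]
      by eventually_elim (rule horizontal_direction_agree[OF _ W X(3)])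
    then show ?thesis
      using horizontal_direction_agree[OF p V W3(1)] n2.nabla_local_right[OF v(1) W3] by simp
  qed
  then show ?thesis using adapted_curvature[OF p X(3), of f] by simp
qed

lemma adapted_agree:
  assumes p: "p \<in> U" and V: "V \<in> n1.\<X>" and W: "W \<in> n1.\<X>"
  shows "nabla V W p = nabla' V W p"
proof
  fix f
  note X = adapted_vfields
  let ?Z = "n1.bracket_frame X1 X2"
  note Z = n1.adapted_frame_frame_on[OF F]
  obtain v where v: "\<And>f. V p f = (\<Sum>i\<in>UNIV. v i * ?Z i p f)"
    using Z p n1.vfields_tangent[OF V, of p] unfolding n1.frame_on_def by blast
  obtain w where w: "\<And>f. W p f = (\<Sum>i\<in>UNIV. w i * ?Z i p f)"
    using Z p n1.vfields_tangent[OF W, of p] unfolding n1.frame_on_def by blast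
  have "nabla X3 W p f = nabla' X3 W p f"
    using difference_tensorial[OF Z p X(3) W w, of f] bracket_horizontal_agree[OF p] bracket_bracket_agree[OF p]
    by (simp add: sum_3)
  then show "nabla V W p f = nabla' V W p f"
    using horizontal_direction_agree[OF p _ W, of X1] horizontal_direction_agree[OF p _ W, of X2]
    by (simp add: n1.nabla_frame_left[OF Z p V W v] n2.nabla_frame_left[OF Z p V W v] sum_3)
qed

end

lemma connections_agree:
  assumes "V \<in> n1.\<X>" "W \<in> n1.\<X>"
  shows "nabla V W = nabla' V W"
proof
  fix p
  obtain U X1 X2 where "p \<in> U" "n1.adapted_frame U X1 X2"
    by (rule n1.adapted_frame_exists)
  then show "nabla V W p = nabla' V W p"
    using adapted_agree assms by blast
qed

end

text \<open>The induced connection is evaluated on global extensions, so equality on global fields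
  carries over to every open set; this yields equal horizontal curvatures.\<close>

lemma restrict_connection_cong:
  assumes "\<forall>V\<in>vfields A UNIV. \<forall>W\<in>vfields A UNIV. nabla V W = nabla' V W"
  shows "restrict_connection A nabla U = restrict_connection A nabla' U"
  unfolding restrict_connection_def by (intro ext if_cong refl arg_cong[where f = The] bex_cong) (simp add: assms)

theorem theorem8:
  fixes A :: "('a::{t2_space, second_countable_topology}) chart set"
    and H :: "'a distribution"
    and ip :: "'a fiber_metric"
    and pos :: "'a \<Rightarrow> 'a tvec \<Rightarrow> 'a tvec \<Rightarrow> bool"
    and g :: "'a cometric"
    and nabla nabla' :: "'a connection"
  assumes "sub_riemannian_2_3 A H ip"
    and "hbundle_orientation A H pos"
    and "associated_cometric A H ip g"
    and "affine_connection A nabla" and "compatible A g nabla"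
    and "affine_connection A nabla'" and "compatible A g nabla'"
  shows "(\<forall>V\<in>vfields A UNIV. \<forall>W\<in>vfields A UNIV. nabla V W = nabla' V W) \<longleftrightarrow>
     (\<forall>V1\<in>vfields A UNIV. \<forall>V2\<in>vfields A UNIV. torsion A nabla V1 V2 = torsion A nabla' V1 V2) \<and>
     (\<forall>U X1 X2. oriented_orthonormal_frame A H ip pos U X1 X2 \<longrightarrow>
        (\<forall>V\<in>vfields A U. \<forall>p\<in>U.
           horizontal_curvature A nabla U X1 X2 V p = horizontal_curvature A nabla' U X1 X2 V p))"
    (is "?E \<longleftrightarrow> ?T \<and> ?R")
proof
  assume E: ?E
  then have "?T" by (simp add: torsion_def)
  moreover have "?R"
    by (simp add: horizontal_curvature_def restrict_connection_cong[OF E])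
  ultimately show "?T \<and> ?R" ..
next
  assume TR: "?T \<and> ?R"
  \<comment> \<open>The base locale states the atlas condition as an assumption of its own, so it is
    extracted before the interpretation.\<close>
  have "smooth_atlas A" using assms(1) unfolding sub_riemannian_2_3_def by simp
  then interpret two_compatible_connections A H ip pos nabla nabla' g
    using TR assms by unfold_locales blast+
  show ?E using connections_agree by blast
qed

end
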